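(* Let $w\in S_n$, and let $I$ be a set of simple generators of $S_n$. Then $$m(w,I)=\bigvee\nolimits_{w}\,\{s_i\in I\mid s_i\preceq w\},$$ where $\bigvee_w$ denotes the join in the lattice $P_w$.
   Context: $S_n$ is the symmetric group with simple generators $s_i=(i\ i+1)$, $1\le i\le n-1$, Coxeter length $\ell$, and identity $e$. The (strong) Bruhat order $\preceq$ on $S_n$ has cover relations $x \prec xt$ whenever $t$ is a transposition with $\ell(xt)=\ell(x)+1$. Write $[e,w]=\{u\in S_n \mid u\preceq w\}$. For $u\in S_n$ let $\boldsymbol{u}=(u^{-1}(1),\ldots,u^{-1}(n))\in\mathbb{R}^n$. The Bruhat interval polytope of $w$ is $Q_w=\mathrm{Conv}(\{\boldsymbol{u}\mid u\preceq w\})\subset\mathbb{R}^n$; its vertices are exactly the points $\boldsymbol{u}$ with $u\in[e,w]$. The 1-skeleton poset $(P_w,\leq_w)$ has underlying set $[e,w]$ and cover relations $u\lessdot_w v$ whenever $Q_w$ has an edge between $\boldsymbol{u}$ and $\boldsymbol{v}$ and $\ell(v)>\ell(u)$. The poset $P_w$ is a lattice with minimum element $e$ (so the empty join is $e$). $S_n(I)$ denotes the Young subgroup of $S_n$ generated by $I\subseteq\{s_1,\ldots,s_{n-1}\}$. By a theorem of Billey, Fan and Losonczy, the set $S_n(I)\cap[e,w]$ has a unique maximal element under Bruhat order; it is denoted $m(w,I)$. *)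

theory Defs
  imports "HOL-Analysis.Polytope" "HOL-Algebra.Sym_Groups"
begin

text \<open>
  The symmetric group $S_n$ is \<^term>\<open>sym_group n\<close>: permutations of \<^term>\<open>{1..n}\<close>, fixing
  every other natural number, with product \<^term>\<open>(\<circ>)\<close>.
\<close>

definition simple_generators :: "nat \<Rightarrow> (nat \<Rightarrow> nat) set"
  where "simple_generators n = {Transposition.transpose i (i + 1) | i. 1 \<le> i \<and> i \<le> n - 1}"

definition coxeter_length :: "nat \<Rightarrow> (nat \<Rightarrow> nat) \<Rightarrow> nat"
  where "coxeter_length n u =
    (LEAST k. \<exists>ss. set ss \<subseteq> simple_generators n \<and> length ss = k \<and> u = foldr (\<circ>) ss id)"

definition bruhat_cover :: "nat \<Rightarrow> (nat \<Rightarrow> nat) \<Rightarrow> (nat \<Rightarrow> nat) \<Rightarrow> bool"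
  where "bruhat_cover n x y \<longleftrightarrow> x \<in> carrier (sym_group n) \<and>
    (\<exists>a\<in>{1..n}. \<exists>b\<in>{1..n}. a \<noteq> b \<and> y = x \<circ> Transposition.transpose a b) \<and>
    coxeter_length n y = coxeter_length n x + 1"

abbreviation bruhat_le :: "nat \<Rightarrow> (nat \<Rightarrow> nat) \<Rightarrow> (nat \<Rightarrow> nat) \<Rightarrow> bool"
  where "bruhat_le n \<equiv> (bruhat_cover n)\<^sup>*\<^sup>*"

definition bruhat_ideal :: "nat \<Rightarrow> (nat \<Rightarrow> nat) \<Rightarrow> (nat \<Rightarrow> nat) set"
  where "bruhat_ideal n w = {u \<in> carrier (sym_group n). bruhat_le n u w}"

text \<open>
  Euclidean space $\mathbb{R}^n$ is \<^typ>\<open>real^'n\<close> with $n$ the cardinality of the linearly ordered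
  index type \<^typ>\<open>'n\<close>. The coordinates are numbered from 1 to $n$ in increasing order of the
  index, and \<^term>\<open>pos i\<close> is the number of the coordinate \<^term>\<open>i\<close>.
\<close>

definition pos :: "'n::{finite,linorder} \<Rightarrow> nat"
  where "pos i = card {..i}"

lemma pos_less_iff: "pos i < pos j \<longleftrightarrow> i < j"
proof -
  have mono: "pos a < pos b" if "a < b" for a b :: 'a
    unfolding pos_def using that by (intro psubset_card_mono) auto
  show ?thesis
    using mono[of i j] mono[of j i] by (cases i j rule: linorder_cases) (auto simp: not_less_iff_gr_or_eq)
qed

lemma bij_betw_pos: "bij_betw pos (UNIV :: 'n::{finite,linorder} set) {1..CARD('n)}"
proof -
  have inj: "inj (pos :: 'n \<Rightarrow> nat)"
    by (rule linorder_injI) (use pos_less_iff in \<open>force simp: less_le\<close>)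
  have "pos i \<in> {1..CARD('n)}" for i :: 'n
    unfolding pos_def by (auto simp: Suc_le_eq card_gt_0_iff intro: card_mono)
  then have "range (pos :: 'n \<Rightarrow> nat) = {1..CARD('n)}"
    by (intro card_subset_eq) (auto simp: card_image[OF inj])
  with inj show ?thesis
    by (simp add: bij_betw_def)
qed

definition perm_vec :: "(nat \<Rightarrow> nat) \<Rightarrow> real^'n::{finite,linorder}"
  where "perm_vec u = (\<chi> i. real ((inv\<^bsub>sym_group CARD('n)\<^esub> u) (pos i)))"

definition bruhat_interval_polytope :: "(nat \<Rightarrow> nat) \<Rightarrow> (real^'n::{finite,linorder}) set"
  where "bruhat_interval_polytope w = convex hull (perm_vec ` bruhat_ideal CARD('n) w)"

definition skeleton_cover ::
    "'n::{finite,linorder} itself \<Rightarrow> (nat \<Rightarrow> nat) \<Rightarrow> (nat \<Rightarrow> nat) \<Rightarrow> (nat \<Rightarrow> nat) \<Rightarrow> bool"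
  where "skeleton_cover TYPE('n) w u v \<longleftrightarrow>
    u \<in> bruhat_ideal CARD('n) w \<and> v \<in> bruhat_ideal CARD('n) w \<and>
    closed_segment (perm_vec u :: (real, 'n) vec) (perm_vec v) edge_of bruhat_interval_polytope w \<and>
    coxeter_length CARD('n) u < coxeter_length CARD('n) v"

text \<open>
  The 1-skeleton poset $P_w$. The argument \<^term>\<open>TYPE('n)\<close> is needed because the index type of
  the ambient space of the polytope does not occur in the type of the poset.
\<close>

definition skeleton_poset :: "'n::{finite,linorder} itself \<Rightarrow> (nat \<Rightarrow> nat) \<Rightarrow> (nat \<Rightarrow> nat) gorder"
  where "skeleton_poset TYPE('n) w =
    \<lparr>carrier = bruhat_ideal CARD('n) w, eq = (=), le = (skeleton_cover TYPE('n) w)\<^sup>*\<^sup>*\<rparr>"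

definition young_subgroup :: "nat \<Rightarrow> (nat \<Rightarrow> nat) set \<Rightarrow> (nat \<Rightarrow> nat) set"
  where "young_subgroup n I = generate (sym_group n) I"

definition max_young :: "nat \<Rightarrow> (nat \<Rightarrow> nat) \<Rightarrow> (nat \<Rightarrow> nat) set \<Rightarrow> (nat \<Rightarrow> nat)"
  where "max_young n w I =
    (THE m. m \<in> young_subgroup n I \<inter> bruhat_ideal n w \<and>
      (\<forall>x \<in> young_subgroup n I \<inter> bruhat_ideal n w. bruhat_le n m x \<longrightarrow> x = m))"

end

theory Submission
  imports Defs
begin

text \<open>
  The proof studies which linear functionals are maximal at which vertex of the polytope. Write
  \<open>\<^bold>u\<close> for the vertex of \<open>u\<close>. A permutation \<open>c\<close> of \<open>{1..n}\<close> is also a functional, a point in a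
  chamber of the braid arrangement, and inclusion of inversion sets is the weak order on the
  chambers.

  The functionals that are maximal at \<open>\<^bold>u\<close> are cut out by the inequalities \<open>c a \<le> c b\<close> for
  the pairs \<open>(a, b)\<close> in \<open>label_rel n w u\<close>, one for every transposition that keeps \<open>u\<close> inside the
  Bruhat interval (\<open>optimal_iff_monotone\<close>). Hence each chamber belongs to a single vertex, and
  walking up in the weak order of chambers means walking up along edges in the skeleton:
  if \<open>c\<close> is maximal at \<open>\<^bold>u\<close>, \<open>d\<close> at \<open>\<^bold>x\<close>, and all inversions of \<open>c\<close> are inversions of \<open>d\<close>, then
  \<open>u \<le>\<^sub>w x\<close> (\<open>skeleton_le_of_inversions\<close>).

  Let \<open>m\<close> be the largest element of the Young subgroup below \<open>w\<close>. The chamber that reverses every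
  block of \<open>I\<close> belongs to \<open>m\<close>, and it inverts the pair that is inverted by any one generator in \<open>I\<close>. So \<open>m\<close>
  is an upper bound of the generators below \<open>w\<close>.

  Conversely, let \<open>x\<close> be an upper bound, and order the labels by the transitive closure of
  \<open>label_rel n w x\<close>. This order is such that for \<open>a < c < b\<close> with \<open>a\<close> below \<open>b\<close> also \<open>a\<close> is below
  \<open>c\<close> or \<open>c\<close> is below \<open>b\<close> (\<open>label_rel_trancl_cotrans\<close>). Two facts follow. There is a chamber of
  \<open>x\<close> which inverts every pair \<open>a < b\<close> except those with \<open>a\<close> below \<open>b\<close>. And if no relation from
  \<open>i\<close> to \<open>i + 1\<close> holds for the generators \<open>s\<^sub>i\<close> considered, then none from \<open>a\<close> to \<open>b\<close> holds
  within a block, so that this chamber contains all inversions of \<open>m\<close> and \<open>m \<le>\<^sub>w x\<close>. It remains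
  to see that \<open>s\<^sub>i \<le>\<^sub>w x\<close> excludes the relation from \<open>i\<close> to \<open>i + 1\<close>. It does not hold at \<open>s\<^sub>i\<close>,
  and it cannot arise along an upward edge (\<open>label_rel_edge_adjacent\<close>), because the orders at the
  two ends of an edge become equal once the two labels exchanged along it are identified.
\<close>

(* Keeps the simplifier from rewriting the index set {1..n} to {Suc 0..n}. *)
declare One_nat_def [simp del]

section \<open>Length as number of inversions\<close>

abbreviation swap :: "nat \<Rightarrow> nat \<Rightarrow> nat \<Rightarrow> nat"
  where "swap \<equiv> Transposition.transpose"

abbreviation adj_swap :: "nat \<Rightarrow> nat \<Rightarrow> nat"
  where "adj_swap i \<equiv> Transposition.transpose i (Suc i)"

definition inversions :: "nat \<Rightarrow> (nat \<Rightarrow> nat) \<Rightarrow> (nat \<times> nat) set"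
  where "inversions n u = {(j, k). 1 \<le> j \<and> j < k \<and> k \<le> n \<and> u k < u j}"

lemma finite_inversions [simp]: "finite (inversions n u)"
  by (rule finite_subset[of _ "{1..n} \<times> {1..n}"]) (auto simp: inversions_def)

lemma swap_permutes: "j \<in> {1..n} \<Longrightarrow> k \<in> {1..n} \<Longrightarrow> swap j k permutes {1..n}"
  by (rule permutes_swap_id)

lemma adj_swap_permutes: "1 \<le> i \<Longrightarrow> i < n \<Longrightarrow> adj_swap i permutes {1..n}"
  by (rule swap_permutes) auto

lemma adj_swap_comp_permutes:
  "u permutes {1..n} \<Longrightarrow> 1 \<le> i \<Longrightarrow> i < n \<Longrightarrow> adj_swap i \<circ> u permutes {1..n}"
  by (intro permutes_compose adj_swap_permutes)

lemma comp_swap_permutes: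
  "u permutes {1..n} \<Longrightarrow> 1 \<le> j \<Longrightarrow> j < k \<Longrightarrow> k \<le> n \<Longrightarrow> u \<circ> swap j k permutes {1..n}"
  by (intro permutes_compose swap_permutes) auto

lemma adj_swap_comp_cancel [simp]: "adj_swap i \<circ> (adj_swap i \<circ> u) = u"
  by (simp add: fun_eq_iff)

lemma comp_swap_cancel [simp]: "u \<circ> swap j k \<circ> swap j k = u"
  by (simp add: fun_eq_iff)

lemma permutes_position:
  assumes "u permutes {1..n}" "a \<in> {1..n}"
  obtains j where "1 \<le> j" "j \<le> n" "u j = a" "inv' u a = j"
proof -
  have "u (inv' u a) = a" "inv' u a \<in> {1..n}"
    using assms permutes_inverses(1) permutes_in_image[OF permutes_inv] by metis+
  then show ?thesis using that by auto
qed

lemma permutes_apply_eq_iff: "u permutes S \<Longrightarrow> u j = u k \<longleftrightarrow> j = k"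
  using permutes_inj injD by metis

lemma adj_swap_comp_eq:
  assumes "u permutes {1..n}" "u p = i" "u q = Suc i"
  shows "adj_swap i \<circ> u = u \<circ> swap p q"
  using transpose_comp_eq[OF permutes_bij[OF assms(1)], of i "Suc i"]
    permutes_inverses(2)[OF assms(1), of p] permutes_inverses(2)[OF assms(1), of q] assms(2,3)
  by simp

lemma adjacent_positions:
  assumes "u permutes {1..n}" "1 \<le> i" "i < n"
  obtains p q where "1 \<le> p" "p \<le> n" "1 \<le> q" "q \<le> n" "u p = i" "u q = Suc i" "p \<noteq> q"
proof -
  obtain p where "1 \<le> p" "p \<le> n" "u p = i"
    using assms by (auto intro: permutes_position[OF assms(1), of i])
  moreover obtain q where "1 \<le> q" "q \<le> n" "u q = Suc i"
    using assms by (auto intro: permutes_position[OF assms(1), of "Suc i"])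
  ultimately show ?thesis using that[of p q] by force
qed

lemma adj_swap_less_iff:
  "{a, b} \<noteq> {i, Suc i} \<Longrightarrow> adj_swap i b < adj_swap i a \<longleftrightarrow> b < a"
proof -
  assume "{a, b} \<noteq> {i, Suc i}"
  then have "\<not> (a = i \<and> b = Suc i)" "\<not> (a = Suc i \<and> b = i)" by auto
  then show ?thesis
    by (cases "a = i"; cases "a = Suc i"; cases "b = i"; cases "b = Suc i") auto
qed

text \<open>
  Only the order of the two adjacent values \<^term>\<open>i\<close> and \<^term>\<open>Suc i\<close> is affected by
  exchanging them, so exactly one pair of positions becomes an inversion.
\<close>

lemma inversions_adj_swap:
  assumes u: "u permutes {1..n}" and "1 \<le> p" "p < q" "q \<le> n" and "u p = i" "u q = Suc i"
  shows "inversions n (adj_swap i \<circ> u) = insert (p, q) (inversions n u)"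
    and "(p, q) \<notin> inversions n u"
proof -
  show "(p, q) \<notin> inversions n u"
    using assms by (simp add: inversions_def)
  have *: "adj_swap i (u k) < adj_swap i (u j) \<longleftrightarrow> u k < u j" if "{j, k} \<noteq> {p, q}" for j k
  proof (rule adj_swap_less_iff)
    have "u ` {j, k} \<noteq> u ` {p, q}"
      unfolding inj_image_eq_iff[OF permutes_inj[OF u]] by (rule that)
    then show "{u j, u k} \<noteq> {i, Suc i}" using assms(5,6) by simp
  qed
  show "inversions n (adj_swap i \<circ> u) = insert (p, q) (inversions n u)"
  proof (rule Set.set_eqI)
    fix x :: "nat \<times> nat"
    obtain j k where x: "x = (j, k)" by (cases x)
    show "x \<in> inversions n (adj_swap i \<circ> u) \<longleftrightarrow> x \<in> insert (p, q) (inversions n u)"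
    proof (cases "{j, k} = {p, q}")
      case True
      then have "(j = p \<and> k = q) \<or> (j = q \<and> k = p)" by (auto simp: doubleton_eq_iff)
      then show ?thesis using assms x by (auto simp: inversions_def)
    next
      case False
      then show ?thesis using *[OF False] x by (auto simp: inversions_def)
    qed
  qed
qed

lemma card_inversions_adj_swap:
  assumes "u permutes {1..n}" "1 \<le> p" "p < q" "q \<le> n" "u p = i" "u q = Suc i"
  shows "card (inversions n (adj_swap i \<circ> u)) = Suc (card (inversions n u))"
  using inversions_adj_swap[OF assms] by simp

lemma permutes_ascending_imp_id:
  assumes f: "f permutes {1..n}" and asc: "\<And>i. 1 \<le> i \<Longrightarrow> i < n \<Longrightarrow> f i < f (Suc i)"
  shows "f = id"
proof (rule permutes_natset_ge[OF f], rule ballI)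
  fix i assume "i \<in> {1..n}"
  then have "1 \<le> i" "i \<le> n" by auto
  then show "i \<le> f i"
  proof (induction i rule: nat_induct_at_least)
    case base
    then show ?case using permutes_in_image[OF f, of 1] by auto
  next
    case (Suc i)
    then show ?case using asc[of i] by auto
  qed
qed

lemma exists_left_descent:
  assumes u: "u permutes {1..n}" and "u \<noteq> id"
  obtains i p q where "1 \<le> i" "i < n" "1 \<le> p" "p < q" "q \<le> n" "u p = Suc i" "u q = i"
proof -
  have "inv' u \<noteq> id" using assms by (metis inv_id permutes_inv_inv)
  then obtain i where i: "1 \<le> i" "i < n" "\<not> inv' u i < inv' u (Suc i)"
    using permutes_ascending_imp_id[OF permutes_inv[OF u]] by blast
  obtain q where q: "1 \<le> q" "q \<le> n" "u q = i" "inv' u i = q"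
    using i by (auto intro: permutes_position[OF u, of i])
  obtain p where p: "1 \<le> p" "p \<le> n" "u p = Suc i" "inv' u (Suc i) = p"
    using i by (auto intro: permutes_position[OF u, of "Suc i"])
  have "p \<noteq> q" using p q by auto
  then show ?thesis using that[of i p q] i p q by auto
qed

text \<open>
  Left multiplication by an adjacent transposition changes the Bruhat interval below \<open>w\<close> in a
  controlled way, so inductions on \<open>w\<close> take this form.
\<close>

lemma permutes_left_weak_induct [consumes 1, case_names id step]:
  assumes "u permutes {1..n}" and "P id"
    and "\<And>u i p q. u permutes {1..n} \<Longrightarrow> 1 \<le> i \<Longrightarrow> i < n \<Longrightarrow> 1 \<le> p \<Longrightarrow> p < q \<Longrightarrow> q \<le> n \<Longrightarrow>
      u p = i \<Longrightarrow> u q = Suc i \<Longrightarrow> P u \<Longrightarrow> P (adj_swap i \<circ> u)"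
  shows "P u"
  using assms(1)
proof (induction "card (inversions n u)" arbitrary: u rule: less_induct)
  case less
  show ?case
  proof (cases "u = id")
    case True
    then show ?thesis using assms(2) by simp
  next
    case False
    obtain i p q where i: "1 \<le> i" "i < n" and pq: "1 \<le> p" "p < q" "q \<le> n" "u p = Suc i" "u q = i"
      using exists_left_descent[OF less.prems False] by metis
    let ?v = "adj_swap i \<circ> u"
    have v: "?v permutes {1..n}" "?v p = i" "?v q = Suc i"
      using adj_swap_comp_permutes[OF less.prems i] pq by auto
    have "card (inversions n u) = Suc (card (inversions n ?v))"
      using card_inversions_adj_swap[of ?v n p q i] v pq by simp
    then have "P ?v" using less.hyps[OF _ v(1)] by simp
    then show ?thesis
      using assms(3)[of ?v i p q] v i pq by simp
  qed
qed

lemma inversions_id [simp]: "inversions n id = {}"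
  by (auto simp: inversions_def)

lemma card_inversions_adj_swap_le:
  assumes u: "u permutes {1..n}" and i: "1 \<le> i" "i < n"
  shows "card (inversions n (adj_swap i \<circ> u)) \<le> Suc (card (inversions n u))"
proof -
  obtain p q where p: "1 \<le> p" "p \<le> n" "u p = i" and q: "1 \<le> q" "q \<le> n" "u q = Suc i"
    and "p \<noteq> q" using adjacent_positions[OF assms] .
  then consider "p < q" | "q < p" by linarith
  then show ?thesis
  proof cases
    case 1
    then show ?thesis using card_inversions_adj_swap[OF u p(1) _ q(2) p(3) q(3)] by simp
  next
    case 2
    have "Suc (card (inversions n (adj_swap i \<circ> u))) = card (inversions n u)"
      using card_inversions_adj_swap[of "adj_swap i \<circ> u" n q p i]
        adj_swap_comp_permutes[OF u i] 2 p q
      by simp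
    then show ?thesis by simp
  qed
qed

lemma simple_generators_iff:
  "s \<in> simple_generators n \<longleftrightarrow> (\<exists>i. 1 \<le> i \<and> i < n \<and> s = adj_swap i)"
  unfolding simple_generators_def Suc_eq_plus1
proof safe
  fix i assume "1 \<le> i" "i \<le> n - 1"
  then show "\<exists>j\<ge>1. j < n \<and> swap i (i + 1) = swap j (j + 1)" by (intro exI[of _ i]) auto
next
  fix i assume "1 \<le> i" "i < n"
  then show "\<exists>j. swap i (i + 1) = swap j (j + 1) \<and> 1 \<le> j \<and> j \<le> n - 1"
    by (intro exI[of _ i]) auto
qed

text \<open>
  A letter of a word changes the number of inversions by at most one, so no word is shorter than
  that number; sorting by adjacent transpositions produces a word of exactly this length.
\<close>

lemma coxeter_length_eq_card_inversions:
  assumes "u permutes {1..n}"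
  shows "coxeter_length n u = card (inversions n u)"
proof -
  let ?word = "\<lambda>u k ss. set ss \<subseteq> simple_generators n \<and> length ss = k \<and> u = foldr (\<circ>) ss id"
  have lower: "foldr (\<circ>) ss id permutes {1..n} \<and>
      card (inversions n (foldr (\<circ>) ss id)) \<le> length ss"
    if "set ss \<subseteq> simple_generators n" for ss
    using that
  proof (induction ss)
    case Nil
    show "foldr (\<circ>) [] id permutes {1..n} \<and>
        card (inversions n (foldr (\<circ>) [] id)) \<le> length []"
      by (simp add: permutes_id)
  next
    case (Cons s ss)
    then obtain i where i: "1 \<le> i" "i < n" "s = adj_swap i"
      by (auto simp: simple_generators_iff)
    let ?v = "foldr (\<circ>) ss id"
    have "?v permutes {1..n} \<and> card (inversions n ?v) \<le> length ss"
      by (rule Cons.IH) (use Cons.prems in simp)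
    then show "foldr (\<circ>) (s # ss) id permutes {1..n} \<and>
        card (inversions n (foldr (\<circ>) (s # ss) id)) \<le> length (s # ss)"
      using card_inversions_adj_swap_le[of ?v n i] adj_swap_comp_permutes[of ?v n i] i by auto
  qed
  have upper: "\<exists>ss. ?word u (card (inversions n u)) ss"
    using assms
  proof (induction rule: permutes_left_weak_induct)
    case id
    show "\<exists>ss. ?word id (card (inversions n id)) ss"
      by (intro exI[of _ "[]"]) simp
  next
    case (step u i p q)
    then obtain ss where "?word u (card (inversions n u)) ss" by blast
    moreover have "adj_swap i \<in> simple_generators n"
      using step by (auto simp: simple_generators_iff)
    ultimately show "\<exists>ss. ?word (adj_swap i \<circ> u) (card (inversions n (adj_swap i \<circ> u))) ss"
      using card_inversions_adj_swap[OF step.hyps(1,4-8)]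
      by (intro exI[of _ "adj_swap i # ss"]) simp
  qed
  show ?thesis
    unfolding coxeter_length_def
    by (rule Least_equality) (use upper lower in auto)
qed

section \<open>Bruhat order through arbitrary reflections\<close>

text \<open>
  Dropping the condition that the length rises by exactly one does not change the transitive
  closure, and without it left multiplication becomes easy to control.
\<close>

definition refl_step :: "nat \<Rightarrow> (nat \<Rightarrow> nat) \<Rightarrow> (nat \<Rightarrow> nat) \<Rightarrow> bool"
  where "refl_step n x y \<longleftrightarrow> x permutes {1..n} \<and>
    (\<exists>j k. 1 \<le> j \<and> j < k \<and> k \<le> n \<and> x j < x k \<and> y = x \<circ> swap j k)"

text \<open>
  Induction on the difference of the two exchanged values: conjugating by the adjacent
  transposition of \<open>a = x j\<close> and \<open>a + 1\<close> reduces this difference by one. As the value \<open>a + 1\<close>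
  does not sit between the positions \<open>j\<close> and \<open>k\<close>, the two multiplications involved change the
  number of inversions by opposite amounts.
\<close>

lemma card_inversions_minimal_swap:
  assumes "x permutes {1..n}" "1 \<le> j" "j < k" "k \<le> n" "x j < x k"
    and "\<And>l. j < l \<Longrightarrow> l < k \<Longrightarrow> x j < x l \<Longrightarrow> x l < x k \<Longrightarrow> False"
  shows "card (inversions n (x \<circ> swap j k)) = Suc (card (inversions n x))"
  using assms
proof (induction "x k - x j" arbitrary: x rule: less_induct)
  case less
  note x = less.prems(1) and jk = less.prems(2-4)
  define a where "a = x j"
  have range: "x m \<in> {1..n}" if "1 \<le> m" "m \<le> n" for m
    using permutes_in_image[OF x, of m] that by auto
  have a: "1 \<le> a" "a < n"
    using range[of j] range[of k] jk less.prems(5) by (auto simp: a_def)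
  obtain l where l: "1 \<le> l" "l \<le> n" "x l = Suc a" "inv' x (Suc a) = l"
    using a by (auto intro: permutes_position[OF x, of "Suc a"])
  show ?case
  proof (cases "l = k")
    case True
    then show ?thesis
      using adj_swap_comp_eq[OF x, of j a k] card_inversions_adj_swap[of x n j k a] x jk l
      by (simp add: a_def)
  next
    case False
    let ?x = "adj_swap a \<circ> x" and ?y = "x \<circ> swap j k"
    have "l \<noteq> j" using l(3) by (auto simp: a_def)
    have big: "Suc a < x k"
      using less.prems(5) False l(3) permutes_apply_eq_iff[OF x, of k l] by (auto simp: a_def)
    have x': "?x permutes {1..n}" using adj_swap_comp_permutes[OF x a] .
    have vals: "?x j = Suc a" "?x k = x k" "?x l = a"
      using big l(3) by (auto simp: a_def)
    have between: False if "j < m" "m < k" "?x j < ?x m" "?x m < ?x k" for m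
    proof -
      have "?x m = x m"
        using that vals by (auto simp: Transposition.transpose_def split: if_splits)
      then show False using less.prems(6)[of m] that vals by (auto simp: a_def)
    qed
    have IH: "card (inversions n (?x \<circ> swap j k)) = Suc (card (inversions n ?x))"
      by (rule less.hyps[OF _ x' jk]) (use vals big between in \<open>auto simp: a_def\<close>)
    have eq: "?x \<circ> swap j k = adj_swap a \<circ> ?y" by (simp add: comp_assoc)
    have y: "?y permutes {1..n}" using comp_swap_permutes[OF x jk] .
    have yvals: "?y k = a" "?y l = Suc a"
      using l \<open>l \<noteq> j\<close> False by (auto simp: a_def)
    have "\<not> (j < l \<and> l < k)" using less.prems(6)[of l] l big by (auto simp: a_def)
    then consider "l < j" | "k < l" using False \<open>l \<noteq> j\<close> by linarith
    then show ?thesis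
    proof cases
      case 1
      have "card (inversions n x) = Suc (card (inversions n ?x))"
        using card_inversions_adj_swap[of ?x n l j a] x' l 1 vals jk by simp
      moreover have "card (inversions n ?y) = Suc (card (inversions n (adj_swap a \<circ> ?y)))"
        using card_inversions_adj_swap[of "adj_swap a \<circ> ?y" n l k a]
          adj_swap_comp_permutes[OF y a] l 1 jk yvals
        by simp
      ultimately show ?thesis using IH eq by simp
    next
      case 2
      have "card (inversions n ?x) = Suc (card (inversions n x))"
        using card_inversions_adj_swap[of x n j l a] x 2 l jk by (simp add: a_def)
      moreover have "card (inversions n (adj_swap a \<circ> ?y)) = Suc (card (inversions n ?y))"
        using card_inversions_adj_swap[of ?y n k l a] y 2 l yvals jk by simp
      ultimately show ?thesis using IH eq by simp
    qed
  qed
qed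

text \<open>
  If some position between \<open>j\<close> and \<open>k\<close> carries an intermediate value, the reflection is a product
  of three upward reflections with smaller differences of values; otherwise it is a cover.
\<close>

lemma refl_step_imp_bruhat_le:
  assumes "x permutes {1..n}" "1 \<le> j" "j < k" "k \<le> n" "x j < x k"
  shows "bruhat_le n x (x \<circ> swap j k)"
  using assms
proof (induction "x k - x j" arbitrary: x j k rule: less_induct)
  case less
  note x = less.prems(1)
  show ?case
  proof (cases "\<exists>l. j < l \<and> l < k \<and> x j < x l \<and> x l < x k")
    case True
    then obtain l where l: "j < l" "l < k" "x j < x l" "x l < x k" by blast
    \<comment> \<open>The values at \<open>j < l < k\<close> run through the patterns 123, 213, 312, 321.\<close>
    define x1 x2 where "x1 = x \<circ> swap j l" and "x2 = x1 \<circ> swap j k"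
    have x1: "x1 permutes {1..n}"
      unfolding x1_def using x l less.prems by (intro comp_swap_permutes) linarith+
    have x2: "x2 permutes {1..n}"
      unfolding x2_def using x1 less.prems by (intro comp_swap_permutes) linarith+
    have vals: "x1 j = x l" "x1 l = x j" "x1 k = x k" "x2 j = x k" "x2 l = x j" "x2 k = x l"
      using l by (simp_all add: x1_def x2_def)
    have range: "1 \<le> l" "l \<le> n" using l less.prems by linarith+
    have "bruhat_le n x x1"
      unfolding x1_def using less.hyps[of x l j] x l less.prems(2) range by simp
    also have "bruhat_le n x1 x2"
      unfolding x2_def using less.hyps[of x1 k j] x1 l less.prems(2-4) vals by simp
    also have "bruhat_le n x2 (x2 \<circ> swap l k)"
      using less.hyps[of x2 k l] x2 l less.prems(4) range vals by simp
    also have "x2 \<circ> swap l k = x \<circ> swap j k"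
    proof
      fix m
      consider "m = j" | "m = l" | "m = k" | "m \<noteq> j" "m \<noteq> l" "m \<noteq> k" by blast
      then show "(x2 \<circ> swap l k) m = (x \<circ> swap j k) m"
        using l by cases (simp_all add: x1_def x2_def)
    qed
    finally show ?thesis .
  next
    case False
    have "bruhat_cover n x (x \<circ> swap j k)"
      unfolding bruhat_cover_def sym_group_carrier
    proof (intro conjI)
      show "\<exists>a\<in>{1..n}. \<exists>b\<in>{1..n}. a \<noteq> b \<and> x \<circ> swap j k = x \<circ> swap a b"
        using less.prems by (intro bexI[of _ j] bexI[of _ k]) auto
      show "coxeter_length n (x \<circ> swap j k) = coxeter_length n x + 1"
        using card_inversions_minimal_swap[OF less.prems] False
          comp_swap_permutes[OF less.prems(1-4)] x
        by (simp add: coxeter_length_eq_card_inversions)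
    qed fact
    then show ?thesis by blast
  qed
qed

lemma bruhat_le_length:
  assumes "bruhat_le n x y"
  shows "x = y \<or> coxeter_length n x < coxeter_length n y"
  using assms by (induction rule: rtranclp_induct) (auto simp: bruhat_cover_def)

lemma bruhat_le_antisym: "bruhat_le n x y \<Longrightarrow> bruhat_le n y x \<Longrightarrow> x = y"
  using bruhat_le_length less_asym by metis

lemma refl_step_length: "refl_step n x y \<Longrightarrow> coxeter_length n x < coxeter_length n y"
proof -
  assume "refl_step n x y"
  then obtain j k where x: "x permutes {1..n}"
    and jk: "1 \<le> j" "j < k" "k \<le> n" "x j < x k" "y = x \<circ> swap j k"
    unfolding refl_step_def by blast
  have "y j \<noteq> x j" using jk by auto
  then show ?thesis
    using bruhat_le_length refl_step_imp_bruhat_le[OF x jk(1-4)] jk(5) by metis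
qed

lemma bruhat_le_eq_refl_steps: "bruhat_le n = (refl_step n)\<^sup>*\<^sup>*"
proof (rule antisym)
  have "refl_step n x y" if "bruhat_cover n x y" for x y
  proof -
    from that obtain a b where x: "x permutes {1..n}"
      and ab: "a \<in> {1..n}" "b \<in> {1..n}" "a \<noteq> b" "y = x \<circ> swap a b"
      and len: "coxeter_length n y = coxeter_length n x + 1"
      unfolding bruhat_cover_def sym_group_carrier by blast
    define j k where "j = min a b" and "k = max a b"
    have jk: "1 \<le> j" "j < k" "k \<le> n" "y = x \<circ> swap j k"
      using ab by (auto simp: j_def k_def min_def max_def transpose_commute)
    have "x j \<noteq> x k" using permutes_apply_eq_iff[OF x] jk by simp
    moreover have "\<not> x k < x j"
    proof
      assume "x k < x j"
      then have "refl_step n y x"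
        unfolding refl_step_def using jk comp_swap_permutes[OF x jk(1-3)]
        by (intro conjI exI[of _ j] exI[of _ k]) auto
      then show False using refl_step_length len by fastforce
    qed
    ultimately show ?thesis unfolding refl_step_def using x jk by force
  qed
  then show "bruhat_le n \<le> (refl_step n)\<^sup>*\<^sup>*"
    by (intro rtranclp_mono) auto
next
  have step: "bruhat_le n x y" if "refl_step n x y" for x y
    using that refl_step_imp_bruhat_le unfolding refl_step_def by blast
  have "bruhat_le n x y" if "(refl_step n)\<^sup>*\<^sup>* x y" for x y
    using that by (induction rule: rtranclp_induct) (blast intro: rtranclp_trans step)+
  then show "(refl_step n)\<^sup>*\<^sup>* \<le> bruhat_le n" by auto
qed

lemma bruhat_le_permutes: "bruhat_le n x y \<Longrightarrow> y permutes {1..n} \<Longrightarrow> x permutes {1..n}"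
  unfolding bruhat_le_eq_refl_steps by (erule converse_rtranclpE) (simp_all add: refl_step_def)

lemma bruhat_ideal_iff:
  "w permutes {1..n} \<Longrightarrow> u \<in> bruhat_ideal n w \<longleftrightarrow> bruhat_le n u w"
  by (auto simp: bruhat_ideal_def sym_group_carrier intro: bruhat_le_permutes)

section \<open>The lifting property\<close>

lemma adj_swap_bruhat_le:
  assumes "u permutes {1..n}" "1 \<le> p" "p < q" "q \<le> n" "u p = i" "u q = Suc i"
  shows "bruhat_le n u (adj_swap i \<circ> u)"
  using refl_step_imp_bruhat_le[of u n p q] adj_swap_comp_eq[of u n p i q] assms by simp

lemma id_bruhat_le: "w permutes {1..n} \<Longrightarrow> bruhat_le n id w"
proof (induction rule: permutes_left_weak_induct)
  case (step u i p q)
  from step.IH adj_swap_bruhat_le[OF step.hyps(1,4-8)]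
  show "bruhat_le n id (adj_swap i \<circ> u)" by (rule rtranclp_trans)
qed (rule rtranclp.rtrancl_refl)

text \<open>
  Left multiplication leaves the exchanged positions alone, and it preserves the order of their
  values unless these are exactly \<open>i\<close> and \<open>i + 1\<close>.
\<close>

lemma refl_step_adj_swap:
  assumes "refl_step n x y" "1 \<le> i" "i < n"
  shows "refl_step n (adj_swap i \<circ> x) (adj_swap i \<circ> y) \<or> y = adj_swap i \<circ> x"
proof -
  from assms obtain j k where x: "x permutes {1..n}"
    and jk: "1 \<le> j" "j < k" "k \<le> n" "x j < x k" "y = x \<circ> swap j k"
    unfolding refl_step_def by blast
  show ?thesis
  proof (cases "x j = i \<and> x k = Suc i")
    case True
    then show ?thesis using adj_swap_comp_eq[OF x, of j i k] jk(5) by simp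
  next
    case False
    then have "adj_swap i (x j) < adj_swap i (x k)"
      using jk(4) by (auto simp: Transposition.transpose_def)
    then have "refl_step n (adj_swap i \<circ> x) (adj_swap i \<circ> x \<circ> swap j k)"
      unfolding refl_step_def using adj_swap_comp_permutes[OF x assms(2,3)] jk(1-3) by auto
    then show ?thesis using jk(5) by (simp add: comp_assoc)
  qed
qed

text \<open>
  The two forms of the lifting property follow by applying the previous lemma along a chain from
  \<open>u\<close> up to \<open>w\<close>: either all of the chain is moved by \<open>s\<close>, or it is cut where it
  contains a step of the form \<open>x < s x\<close>.
\<close>

lemma lifting_up:
  assumes "bruhat_le n u w" "1 \<le> i" "i < n"
  shows "bruhat_le n (adj_swap i \<circ> u) w \<or> bruhat_le n (adj_swap i \<circ> u) (adj_swap i \<circ> w)"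
  using assms(1) unfolding bruhat_le_eq_refl_steps
proof (induction rule: converse_rtranclp_induct)
  case (step u v)
  from refl_step_adj_swap[OF step.hyps(1) assms(2,3)] show ?case
  proof
    assume "refl_step n (adj_swap i \<circ> u) (adj_swap i \<circ> v)"
    with step.IH show ?thesis by (blast intro: converse_rtranclp_into_rtranclp)
  next
    assume "v = adj_swap i \<circ> u"
    with step.hyps(2) show ?thesis by blast
  qed
qed blast

lemma lifting_down:
  assumes "bruhat_le n u w" "1 \<le> i" "i < n"
  shows "bruhat_le n u (adj_swap i \<circ> w) \<or> bruhat_le n (adj_swap i \<circ> u) (adj_swap i \<circ> w)"
  using assms(1) unfolding bruhat_le_eq_refl_steps
proof (induction rule: converse_rtranclp_induct)
  case (step u v)
  from step.IH show ?case
  proof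
    assume "(refl_step n)\<^sup>*\<^sup>* v (adj_swap i \<circ> w)"
    with step.hyps(1) show ?thesis by (blast intro: converse_rtranclp_into_rtranclp)
  next
    assume *: "(refl_step n)\<^sup>*\<^sup>* (adj_swap i \<circ> v) (adj_swap i \<circ> w)"
    from refl_step_adj_swap[OF step.hyps(1) assms(2,3)] show ?thesis
    proof
      assume "refl_step n (adj_swap i \<circ> u) (adj_swap i \<circ> v)"
      with * show ?thesis by (blast intro: converse_rtranclp_into_rtranclp)
    next
      assume "v = adj_swap i \<circ> u"
      with * have "(refl_step n)\<^sup>*\<^sup>* u (adj_swap i \<circ> w)" by (simp only: adj_swap_comp_cancel)
      then show ?thesis ..
    qed
  qed
qed blast

lemma bruhat_le_adj_swap_cases:
  assumes "u permutes {1..n}" "1 \<le> i" "i < n"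
  obtains (up) p q where "1 \<le> p" "p < q" "q \<le> n" "u p = i" "u q = Suc i"
      "bruhat_le n u (adj_swap i \<circ> u)"
  | (down) p q where "1 \<le> p" "p < q" "q \<le> n" "u p = Suc i" "u q = i"
      "bruhat_le n (adj_swap i \<circ> u) u"
proof -
  obtain p q where pq: "1 \<le> p" "p \<le> n" "1 \<le> q" "q \<le> n" "u p = i" "u q = Suc i" "p \<noteq> q"
    using adjacent_positions[OF assms] .
  show ?thesis
  proof (cases "p < q")
    case True
    then show ?thesis using up[of p q] adj_swap_bruhat_le[of u n p q i] assms pq by simp
  next
    case False
    then have "q < p" using pq by simp
    then have "bruhat_le n (adj_swap i \<circ> u) (adj_swap i \<circ> (adj_swap i \<circ> u))"
      using adj_swap_bruhat_le[of "adj_swap i \<circ> u" n q p i] adj_swap_comp_permutes[OF assms] pq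
      by simp
    then have "bruhat_le n (adj_swap i \<circ> u) u" by simp
    then show ?thesis using down[of q p] pq \<open>q < p\<close> by simp
  qed
qed

text \<open>
  For a left ascent \<open>s\<close> of \<open>w\<close>, the interval below \<open>s w\<close> is the union of the interval below
  \<open>w\<close> and its image under \<open>s\<close>. All inductions on \<open>w\<close> below rest on these three consequences of
  the lifting property.
\<close>

lemma
  assumes i: "1 \<le> i" "i < n" and asc: "bruhat_le n w (adj_swap i \<circ> w)"
  shows bruhat_le_ascent_up: "bruhat_le n u w \<Longrightarrow> bruhat_le n (adj_swap i \<circ> u) (adj_swap i \<circ> w)"
    and bruhat_le_ascent_cases: "bruhat_le n u (adj_swap i \<circ> w) \<Longrightarrow>
      bruhat_le n u w \<or> bruhat_le n (adj_swap i \<circ> u) w"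
    and bruhat_le_ascent_stable: "bruhat_le n u (adj_swap i \<circ> w) \<Longrightarrow>
      bruhat_le n (adj_swap i \<circ> u) (adj_swap i \<circ> w)"
proof -
  show up: "bruhat_le n (adj_swap i \<circ> u) (adj_swap i \<circ> w)" if "bruhat_le n u w" for u
    using lifting_up[OF that i] asc by (blast intro: rtranclp_trans)
  show cases: "bruhat_le n u w \<or> bruhat_le n (adj_swap i \<circ> u) w"
    if "bruhat_le n u (adj_swap i \<circ> w)"
    using lifting_down[OF that i] by simp
  show "bruhat_le n (adj_swap i \<circ> u) (adj_swap i \<circ> w)"
    if "bruhat_le n u (adj_swap i \<circ> w)"
    using cases[OF that] up asc by (blast intro: rtranclp_trans)
qed

lemma bruhat_le_id: "bruhat_le n u id \<Longrightarrow> u = id"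
  using bruhat_le_length[of n u id] coxeter_length_eq_card_inversions[OF permutes_id, of n] by simp

section \<open>The largest element of a Young subgroup below a permutation\<close>

lemma adj_swap_le_iff: "adj_swap j a \<le> i \<longleftrightarrow> a \<le> i" if "j \<noteq> i" for a i j :: nat
  using that by (cases "a = j"; cases "a = Suc j") auto

lemma simple_generators_subset_carrier: "simple_generators n \<subseteq> carrier (sym_group n)"
  by (auto simp: simple_generators_iff sym_group_carrier intro: adj_swap_permutes)

lemma generatorE:
  assumes "I \<subseteq> simple_generators n" "s \<in> I"
  obtains i where "1 \<le> i" "i < n" "s = adj_swap i"
  using assms simple_generators_iff by blast

lemma young_subgroup_permutes:
  "I \<subseteq> simple_generators n \<Longrightarrow> u \<in> young_subgroup n I \<Longrightarrow> u permutes {1..n}"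
  unfolding young_subgroup_def
  using group.generate_in_carrier[OF sym_group_is_group] simple_generators_subset_carrier
    sym_group_carrier by (metis order_trans)

lemma young_subgroup_preserves_initial:
  assumes I: "I \<subseteq> simple_generators n" and u: "u \<in> young_subgroup n I" and i: "adj_swap i \<notin> I"
  shows "u j \<le> i \<longleftrightarrow> j \<le> i"
  using u unfolding young_subgroup_def
proof (induction arbitrary: j rule: generate.induct)
  case one
  then show ?case by (simp add: sym_group_one)
next
  case (incl h)
  then obtain k where "h = adj_swap k" "k \<noteq> i" using I i by (blast elim: generatorE)
  then show ?case using adj_swap_le_iff by simp
next
  case (inv h)
  then obtain k where k: "h = adj_swap k" "k \<noteq> i" using I i by (blast elim: generatorE)
  have "h \<in> carrier (sym_group n)" using inv I simple_generators_subset_carrier by blast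
  then show ?case using k adj_swap_le_iff by simp
next
  case (eng h1 h2)
  then show ?case by (simp add: sym_group_mult)
qed

lemma young_subgroup_mult:
  "u \<in> young_subgroup n I \<Longrightarrow> v \<in> young_subgroup n I \<Longrightarrow> u \<circ> v \<in> young_subgroup n I"
  unfolding young_subgroup_def using generate.eng[of u "sym_group n" I v] by (simp add: sym_group_mult)

lemma young_subgroup_generator: "s \<in> I \<Longrightarrow> s \<in> young_subgroup n I"
  unfolding young_subgroup_def by (rule generate.incl)

lemma id_in_young_subgroup: "id \<in> young_subgroup n I"
  unfolding young_subgroup_def using generate.one[of "sym_group n" I] by (simp add: sym_group_one)

lemma young_subgroup_mono: "I \<subseteq> J \<Longrightarrow> young_subgroup n I \<subseteq> young_subgroup n J"
  unfolding young_subgroup_def by (rule group.mono_generate[OF sym_group_is_group])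

lemma young_subgroup_inversion:
  assumes "I \<subseteq> simple_generators n" "u \<in> young_subgroup n I"
    and "inv' u b < inv' u a" "a \<le> i" "i < b"
  shows "adj_swap i \<in> I"
proof (rule ccontr)
  assume "adj_swap i \<notin> I"
  note * = young_subgroup_preserves_initial[OF assms(1,2) this]
  have "u permutes {1..n}" using young_subgroup_permutes[OF assms(1,2)] .
  then have "inv' u a \<le> i" "\<not> inv' u b \<le> i"
    using *[of "inv' u a"] *[of "inv' u b"] assms(4,5) by (simp_all add: permutes_inverses)
  then show False using assms(3) by simp
qed

text \<open>For \<open>a < b\<close>: both lie in one block of the Young subgroup generated by \<open>I\<close>.\<close>

definition linked :: "(nat \<Rightarrow> nat) set \<Rightarrow> nat \<Rightarrow> nat \<Rightarrow> bool"
  where "linked I a b \<longleftrightarrow> (\<forall>i. a \<le> i \<and> i < b \<longrightarrow> adj_swap i \<in> I)"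

lemma swap_in_young_subgroup:
  assumes "a < b" "linked I a b"
  shows "swap a b \<in> young_subgroup n I"
  using assms
proof (induction b)
  case (Suc b)
  have s: "adj_swap b \<in> young_subgroup n I"
    using Suc.prems by (intro young_subgroup_generator) (auto simp: linked_def)
  show "swap a (Suc b) \<in> young_subgroup n I"
  proof (cases "a = b")
    case False
    then have "a < b" using Suc.prems by simp
    have "swap a b \<in> young_subgroup n I"
      using Suc.IH[OF \<open>a < b\<close>] Suc.prems by (auto simp: linked_def)
    then have "adj_swap b \<circ> swap a b \<circ> adj_swap b \<in> young_subgroup n I"
      by (intro young_subgroup_mult s)
    also have "adj_swap b \<circ> swap a b \<circ> adj_swap b = swap a (Suc b)"
    proof
      fix m
      consider "m = a" | "m = b" | "m = Suc b" | "m \<noteq> a" "m \<noteq> b" "m \<noteq> Suc b" by blast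
      then show "(adj_swap b \<circ> swap a b \<circ> adj_swap b) m = swap a (Suc b) m"
        using \<open>a < b\<close> by cases simp_all
    qed
    finally show ?thesis .
  qed (use s in simp)
qed simp

text \<open>
  The theorem of Billey, Fan and Losonczy, by induction on \<open>w = s w'\<close> with \<open>w' < w\<close>: the interval
  below \<open>w\<close> is generated from the one below \<open>w'\<close> by applying \<open>s\<close>. If \<open>s\<close> is not in \<open>I\<close>, no
  element of the Young subgroup is added, and otherwise the maximum for \<open>w'\<close> is replaced by the larger of
  itself and its image under \<open>s\<close>. Every generator used in this way is below \<open>w\<close>.
\<close>

lemma exists_largest_in_young_subgroup:
  assumes "w permutes {1..n}" and I: "I \<subseteq> simple_generators n"
  shows "\<exists>m. bruhat_le n m w \<and> m \<in> young_subgroup n {s \<in> I. bruhat_le n s w} \<and>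
    (\<forall>u \<in> young_subgroup n I. bruhat_le n u w \<longrightarrow> bruhat_le n u m)"
  using assms(1)
proof (induction rule: permutes_left_weak_induct)
  case id
  show "\<exists>m. bruhat_le n m id \<and> m \<in> young_subgroup n {s \<in> I. bruhat_le n s id} \<and>
    (\<forall>u \<in> young_subgroup n I. bruhat_le n u id \<longrightarrow> bruhat_le n u m)"
    using id_in_young_subgroup by (intro exI[of _ id]) simp
next
  case (step w i p q)
  define s where "s = adj_swap i"
  have ss: "s \<circ> (s \<circ> u) = u" for u :: "nat \<Rightarrow> nat" by (simp add: s_def)
  have asc: "bruhat_le n w (s \<circ> w)"
    unfolding s_def by (rule adj_swap_bruhat_le[OF step.hyps(1,4-8)])
  note asc_up = bruhat_le_ascent_up[OF step.hyps(2,3) asc[unfolded s_def], folded s_def]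
    and cases = bruhat_le_ascent_cases[OF step.hyps(2,3) asc[unfolded s_def], folded s_def]
  let ?J = "{t \<in> I. bruhat_le n t w}" and ?K = "{t \<in> I. bruhat_le n t (s \<circ> w)}"
  from step.IH obtain m where m: "bruhat_le n m w" "m \<in> young_subgroup n ?J"
    and max: "\<And>u. u \<in> young_subgroup n I \<Longrightarrow> bruhat_le n u w \<Longrightarrow> bruhat_le n u m"
    by blast
  have perm: "m permutes {1..n}" using bruhat_le_permutes m(1) step.hyps(1) by blast
  have "?J \<subseteq> ?K" using asc by (blast intro: rtranclp_trans)
  then have mK: "m \<in> young_subgroup n ?K" using m(2) young_subgroup_mono by blast
  have msw: "bruhat_le n m (s \<circ> w)" using m(1) asc by (rule rtranclp_trans)
  have lift: "bruhat_le n u m \<or> bruhat_le n u (s \<circ> m)" if "bruhat_le n (s \<circ> u) m" for u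
    using lifting_up[OF that step.hyps(2,3)] unfolding s_def[symmetric] ss .
  have "\<exists>m. bruhat_le n m (s \<circ> w) \<and> m \<in> young_subgroup n ?K \<and>
    (\<forall>u \<in> young_subgroup n I. bruhat_le n u (s \<circ> w) \<longrightarrow> bruhat_le n u m)"
  proof (cases "s \<in> I")
    case sI: True
    have "bruhat_le n (s \<circ> id) (s \<circ> w)" by (rule asc_up[OF id_bruhat_le[OF step.hyps(1)]])
    then have "s \<in> ?K" using sI by simp
    then have sK: "s \<circ> m \<in> young_subgroup n ?K"
      by (intro young_subgroup_mult young_subgroup_generator mK)
    have sI': "s \<circ> u \<in> young_subgroup n I" if "u \<in> young_subgroup n I" for u
      using young_subgroup_mult[OF young_subgroup_generator[OF sI] that] .
    have bound: "bruhat_le n u m \<or> bruhat_le n u (s \<circ> m)"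
      if "u \<in> young_subgroup n I" "bruhat_le n u (s \<circ> w)" for u
      using cases[OF that(2)] lift max[OF that(1)] max[OF sI'[OF that(1)]] by blast
    from perm step.hyps(2,3) show ?thesis
    proof (cases rule: bruhat_le_adj_swap_cases)
      case up
      have "bruhat_le n m (s \<circ> m)" using up unfolding s_def by blast
      then have "bruhat_le n u (s \<circ> m)"
        if "u \<in> young_subgroup n I" "bruhat_le n u (s \<circ> w)" for u
        using bound[OF that] by (blast intro: rtranclp_trans)
      then show ?thesis using asc_up[OF m(1)] sK by blast
    next
      case down
      have "bruhat_le n (s \<circ> m) m" using down unfolding s_def by blast
      then have "bruhat_le n u m"
        if "u \<in> young_subgroup n I" "bruhat_le n u (s \<circ> w)" for u
        using bound[OF that] by (blast intro: rtranclp_trans)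
      then show ?thesis using msw mK by blast
    qed
  next
    case sI: False
    have "bruhat_le n u m" if u: "u \<in> young_subgroup n I" "bruhat_le n u (s \<circ> w)" for u
    proof -
      have "u permutes {1..n}" using young_subgroup_permutes[OF I u(1)] .
      then have "bruhat_le n u (s \<circ> u)" using step.hyps(2,3)
      proof (cases rule: bruhat_le_adj_swap_cases)
        case down
        have "q' \<le> i \<and> \<not> p' \<le> i" if "u p' = Suc i" "u q' = i" for p' q'
          using young_subgroup_preserves_initial[OF I u(1) sI[unfolded s_def], of p']
            young_subgroup_preserves_initial[OF I u(1) sI[unfolded s_def], of q'] that by simp
        with down show ?thesis by fastforce
      qed (simp add: s_def)
      then have "bruhat_le n u w" using cases[OF u(2)] by (blast intro: rtranclp_trans)
      then show ?thesis using max u(1) by blast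
    qed
    then show ?thesis using msw mK by blast
  qed
  then show "\<exists>m. bruhat_le n m (adj_swap i \<circ> w) \<and>
    m \<in> young_subgroup n {t \<in> I. bruhat_le n t (adj_swap i \<circ> w)} \<and>
    (\<forall>u \<in> young_subgroup n I. bruhat_le n u (adj_swap i \<circ> w) \<longrightarrow> bruhat_le n u m)"
    unfolding s_def .
qed

text \<open>The bound for the whole Young subgroup makes the maximal element unique.\<close>

lemma max_young_properties:
  assumes w: "w permutes {1..n}" and I: "I \<subseteq> simple_generators n"
  shows "bruhat_le n (max_young n w I) w"
    and "max_young n w I \<in> young_subgroup n {s \<in> I. bruhat_le n s w}"
    and "\<And>u. u \<in> young_subgroup n I \<Longrightarrow> bruhat_le n u w \<Longrightarrow> bruhat_le n u (max_young n w I)"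
proof -
  obtain m where m: "bruhat_le n m w" "m \<in> young_subgroup n {s \<in> I. bruhat_le n s w}"
    and max: "\<And>u. u \<in> young_subgroup n I \<Longrightarrow> bruhat_le n u w \<Longrightarrow> bruhat_le n u m"
    using exists_largest_in_young_subgroup[OF assms] by blast
  have mI: "m \<in> young_subgroup n I"
    using m(2) young_subgroup_mono[of "{s \<in> I. bruhat_le n s w}" I n] by blast
  have "max_young n w I = m"
    unfolding max_young_def
  proof (rule the_equality)
    show "m \<in> young_subgroup n I \<inter> bruhat_ideal n w \<and>
      (\<forall>x \<in> young_subgroup n I \<inter> bruhat_ideal n w. bruhat_le n m x \<longrightarrow> x = m)"
    proof (intro conjI ballI impI)
      show "m \<in> young_subgroup n I \<inter> bruhat_ideal n w"
        using m(1) mI by (simp add: bruhat_ideal_iff[OF w])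
      fix x assume x: "x \<in> young_subgroup n I \<inter> bruhat_ideal n w" "bruhat_le n m x"
      then have "bruhat_le n x m" using max by (simp add: bruhat_ideal_iff[OF w])
      then show "x = m" using x(2) by (rule bruhat_le_antisym)
    qed
  next
    fix m' assume m': "m' \<in> young_subgroup n I \<inter> bruhat_ideal n w \<and>
      (\<forall>x \<in> young_subgroup n I \<inter> bruhat_ideal n w. bruhat_le n m' x \<longrightarrow> x = m')"
    then have "bruhat_le n m' m" using max by (auto simp: bruhat_ideal_iff[OF w])
    then show "m' = m" using m' m(1) mI by (auto simp: bruhat_ideal_iff[OF w])
  qed
  then show "bruhat_le n (max_young n w I) w"
    and "max_young n w I \<in> young_subgroup n {s \<in> I. bruhat_le n s w}"
    and "\<And>u. u \<in> young_subgroup n I \<Longrightarrow> bruhat_le n u w \<Longrightarrow> bruhat_le n u (max_young n w I)"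
    using m max by auto
qed

section \<open>Linear functionals on a Bruhat interval\<close>

text \<open>
  The value at the vertex of \<open>u\<close> of the linear functional with coefficients \<open>c\<close>: the vertex has
  the coordinate \<open>j\<close> at the label \<open>u j\<close>. Summing over \<open>j\<close> instead of labels avoids inverses.
\<close>

definition pairing :: "nat \<Rightarrow> (nat \<Rightarrow> real) \<Rightarrow> (nat \<Rightarrow> nat) \<Rightarrow> real"
  where "pairing n c u = (\<Sum>j = 1..n. c (u j) * real j)"

text \<open>
  Exchanging the values at positions \<open>j < k\<close> moves the vertex of \<open>u\<close> in the direction
  \<open>e\<^sub>a - e\<^sub>b\<close> with \<open>a = u j\<close> and \<open>b = u k\<close>. So a pair \<open>(a, b)\<close> records that this direction
  stays in the polytope, and that a functional maximised at \<open>u\<close> satisfies \<open>c a \<le> c b\<close>.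
\<close>

definition label_rel :: "nat \<Rightarrow> (nat \<Rightarrow> nat) \<Rightarrow> (nat \<Rightarrow> nat) \<Rightarrow> (nat \<times> nat) set"
  where "label_rel n w u =
    {(u j, u k) | j k. 1 \<le> j \<and> j < k \<and> k \<le> n \<and> bruhat_le n (u \<circ> swap j k) w}"

lemma label_relI:
  "1 \<le> j \<Longrightarrow> j < k \<Longrightarrow> k \<le> n \<Longrightarrow> bruhat_le n (u \<circ> swap j k) w \<Longrightarrow> (u j, u k) \<in> label_rel n w u"
  unfolding label_rel_def by blast

lemma label_relE:
  assumes "(a, b) \<in> label_rel n w u"
  obtains j k where "a = u j" "b = u k" "1 \<le> j" "j < k" "k \<le> n" "bruhat_le n (u \<circ> swap j k) w"
  using assms unfolding label_rel_def by blast

lemma pairing_swap: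
  assumes "1 \<le> j" "j < k" "k \<le> n"
  shows "pairing n c (u \<circ> swap j k) =
    pairing n c u + (c (u j) - c (u k)) * (real k - real j)"
proof -
  have split: "pairing n c v = c (v j) * real j + c (v k) * real k +
      (\<Sum>l \<in> {1..n} - {j} - {k}. c (v l) * real l)" for v
    unfolding pairing_def using assms
    by (simp add: sum.remove[of "{1..n}" j] sum.remove[of "{1..n} - {j}" k])
  have "(\<Sum>l \<in> {1..n} - {j} - {k}. c ((u \<circ> swap j k) l) * real l) =
      (\<Sum>l \<in> {1..n} - {j} - {k}. c (u l) * real l)"
    by (rule sum.cong) auto
  then show ?thesis
    unfolding split[of "u \<circ> swap j k"] split[of u] using assms by (simp add: algebra_simps)
qed

lemma pairing_comp_adj_swap: "pairing n (c \<circ> adj_swap i) (adj_swap i \<circ> u) = pairing n c u"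
  by (simp add: pairing_def)

text \<open>
  At each vertex, the directions to neighbours by a single transposition already span the tangent
  cone of the polytope; this is the dual form of that fact. The induction on \<open>w = s w'\<close> uses that
  the interval below \<open>w\<close> is the union of the one below \<open>w'\<close> and its mirror image: if \<open>u\<close> and
  \<open>v\<close> lie in the same half, the induction hypothesis applies, possibly after reflecting.
\<close>

lemma pairing_le_of_monotone:
  assumes "w permutes {1..n}" "bruhat_le n u w" "bruhat_le n v w"
    and "\<And>a b. (a, b) \<in> label_rel n w u \<Longrightarrow> c a \<le> c b"
  shows "pairing n c v \<le> pairing n c u"
  using assms
proof (induction arbitrary: c u v rule: permutes_left_weak_induct)
  case id
  then show ?case using bruhat_le_id by blast
next
  case (step w i p q)
  define s where "s = adj_swap i"
  have s: "adj_swap i = s" by (simp add: s_def)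
  have ss: "s \<circ> (s \<circ> u) = u" for u :: "nat \<Rightarrow> nat" by (simp add: s_def)
  have asc: "bruhat_le n w (s \<circ> w)"
    unfolding s_def by (rule adj_swap_bruhat_le[OF step.hyps(1,4-8)])
  note up = bruhat_le_ascent_up[OF step.hyps(2,3) asc[unfolded s_def], folded s_def]
    and cases = bruhat_le_ascent_cases[OF step.hyps(2,3) asc[unfolded s_def], folded s_def]
    and stable = bruhat_le_ascent_stable[OF step.hyps(2,3) asc[unfolded s_def], folded s_def]
  define mono where
    "mono c z u \<longleftrightarrow> (\<forall>a b. (a, b) \<in> label_rel n z u \<longrightarrow> c a \<le> c b)" for c :: "nat \<Rightarrow> real" and z u
  have IH: "pairing n c v \<le> pairing n c u"
    if "bruhat_le n u w" "bruhat_le n v w" "mono c w u" for c u v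
    using step.IH[OF that(1,2)] that(3) by (auto simp: mono_def)
  have perm: "s \<circ> w permutes {1..n}"
    unfolding s_def by (rule adj_swap_comp_permutes[OF step.hyps(1-3)])
  have mono_w: "mono c w u" if "mono c (s \<circ> w) u" for c u
    using that asc unfolding mono_def label_rel_def by (blast intro: rtranclp_trans)
  have mono_s: "mono (c \<circ> s) (s \<circ> w) (s \<circ> u)" if "mono c (s \<circ> w) u" for c u
    unfolding mono_def
  proof (intro allI impI)
    fix a b assume "(a, b) \<in> label_rel n (s \<circ> w) (s \<circ> u)"
    then obtain j k where jk: "a = s (u j)" "b = s (u k)" "1 \<le> j" "j < k" "k \<le> n"
      and le: "bruhat_le n (s \<circ> (u \<circ> swap j k)) (s \<circ> w)"
      by (auto elim!: label_relE simp: comp_assoc)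
    have "bruhat_le n (u \<circ> swap j k) (s \<circ> w)" using stable[OF le] by (simp only: ss)
    from label_relI[OF jk(3-5) this] have "c (u j) \<le> c (u k)" using that by (simp add: mono_def)
    then show "(c \<circ> s) a \<le> (c \<circ> s) b" using jk by (simp add: s_def)
  qed
  have pair_s: "pairing n (c \<circ> s) (s \<circ> z) = pairing n c z" for c z
    unfolding s_def by (rule pairing_comp_adj_swap)
  \<comment> \<open>The only case in which \<open>u\<close> and \<open>v\<close> cannot be moved below \<open>w\<close> together: then \<open>v\<close> is
    reached from \<open>s v\<close> by a move in the direction that leads from \<open>u\<close> to \<open>s u\<close>.\<close>
  have mixed: "pairing n c v \<le> pairing n c u"
    if u: "bruhat_le n u w" "\<not> bruhat_le n (s \<circ> u) w"
      and v: "bruhat_le n (s \<circ> v) w" "\<not> bruhat_le n v w"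
      and c: "mono c (s \<circ> w) u" for c u v
  proof -
    have perm_uv: "u permutes {1..n}" "v permutes {1..n}"
      using bruhat_le_permutes[OF u(1) step.hyps(1)]
        bruhat_le_permutes[OF up[OF v(1), unfolded ss] perm] .
    have "c i \<le> c (Suc i)" using perm_uv(1) step.hyps(2,3)
    proof (cases rule: bruhat_le_adj_swap_cases)
      case (up p' q')
      have "bruhat_le n (u \<circ> swap p' q') (s \<circ> w)"
        using bruhat_le_ascent_up[OF step.hyps(2,3) asc[unfolded s_def] u(1)]
          adj_swap_comp_eq[OF perm_uv(1) up(4,5)] by (simp add: s_def)
      from label_relI[OF up(1-3) this] show ?thesis using c up(4,5) by (simp add: mono_def)
    next
      case down
      then have "bruhat_le n (s \<circ> u) w" using u(1) unfolding s_def by (blast intro: rtranclp_trans)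
      then show ?thesis using u(2) by blast
    qed
    moreover from perm_uv(2) step.hyps(2,3)
    have "\<exists>p' q'. 1 \<le> p' \<and> p' < q' \<and> q' \<le> n \<and> v p' = Suc i \<and> v q' = i"
    proof (cases rule: bruhat_le_adj_swap_cases)
      case up
      then have "bruhat_le n v w" using v(1) unfolding s_def by (blast intro: rtranclp_trans)
      then show ?thesis using v(2) by blast
    qed blast
    then obtain p' q' where p': "1 \<le> p'" "p' < q'" "q' \<le> n" "v p' = Suc i" "v q' = i" by blast
    have "s \<circ> v = v \<circ> swap p' q'"
      using adj_swap_comp_eq[OF perm_uv(2) p'(5,4)] by (simp add: s_def transpose_commute)
    then have "pairing n c (s \<circ> v) =
        pairing n c v + (c (Suc i) - c i) * (real q' - real p')"
      using pairing_swap[OF p'(1-3), of c v] p'(4,5) by simp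
    ultimately have "pairing n c v \<le> pairing n c (s \<circ> v)" using p'(2) by simp
    also have "\<dots> \<le> pairing n c u" by (rule IH[OF u(1) v(1) mono_w[OF c]])
    finally show ?thesis .
  qed
  have c: "mono c (s \<circ> w) u" unfolding mono_def s_def using step.prems(3) by blast
  have "bruhat_le n u (s \<circ> w)" "bruhat_le n v (s \<circ> w)"
    using step.prems(1,2) unfolding s by blast+
  then consider "bruhat_le n u w" "bruhat_le n v w"
    | "bruhat_le n (s \<circ> u) w" "bruhat_le n (s \<circ> v) w"
    | "bruhat_le n u w" "\<not> bruhat_le n (s \<circ> u) w" "bruhat_le n (s \<circ> v) w" "\<not> bruhat_le n v w"
    | "bruhat_le n (s \<circ> u) w" "\<not> bruhat_le n u w" "bruhat_le n v w" "\<not> bruhat_le n (s \<circ> v) w"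
    using cases by blast
  then show ?case
  proof cases
    case 1
    then show ?thesis using IH mono_w[OF c] by blast
  next
    case 2
    then have "pairing n (c \<circ> s) (s \<circ> v) \<le> pairing n (c \<circ> s) (s \<circ> u)"
      using IH mono_w[OF mono_s[OF c]] by blast
    then show ?thesis unfolding pair_s .
  next
    case 3
    then show ?thesis using mixed c by blast
  next
    case 4
    then have "pairing n (c \<circ> s) (s \<circ> v) \<le> pairing n (c \<circ> s) (s \<circ> u)"
      using mixed[of "s \<circ> u" "s \<circ> v" "c \<circ> s"] mono_s[OF c] unfolding ss by blast
    then show ?thesis unfolding pair_s .
  qed
qed

definition optimal :: "nat \<Rightarrow> (nat \<Rightarrow> nat) \<Rightarrow> (nat \<Rightarrow> real) \<Rightarrow> (nat \<Rightarrow> nat) \<Rightarrow> bool"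
  where "optimal n w c u \<longleftrightarrow>
    bruhat_le n u w \<and> (\<forall>v. bruhat_le n v w \<longrightarrow> pairing n c v \<le> pairing n c u)"

lemma optimal_iff_monotone:
  assumes "w permutes {1..n}" "bruhat_le n u w"
  shows "optimal n w c u \<longleftrightarrow> (\<forall>(a, b) \<in> label_rel n w u. c a \<le> c b)"
proof
  assume opt: "optimal n w c u"
  show "\<forall>(a, b) \<in> label_rel n w u. c a \<le> c b"
  proof clarify
    fix a b assume "(a, b) \<in> label_rel n w u"
    then obtain j k where jk: "a = u j" "b = u k" "1 \<le> j" "j < k" "k \<le> n"
      and "bruhat_le n (u \<circ> swap j k) w" by (rule label_relE)
    then have "pairing n c (u \<circ> swap j k) \<le> pairing n c u" using opt by (simp add: optimal_def)
    then have "(c a - c b) * (real k - real j) \<le> 0"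
      unfolding pairing_swap[OF jk(3-5)] using jk by simp
    then show "c a \<le> c b" using jk(4) by (simp add: mult_le_0_iff)
  qed
next
  assume "\<forall>(a, b) \<in> label_rel n w u. c a \<le> c b"
  then show "optimal n w c u"
    unfolding optimal_def using pairing_le_of_monotone[OF assms] assms(2) by blast
qed

section \<open>The order on the coordinates attached to a vertex\<close>

lemma label_rel_increasing:
  "u permutes {1..n} \<Longrightarrow> (a, b) \<in> label_rel n w u \<Longrightarrow> inv' u a < inv' u b"
  by (auto elim!: label_relE simp: permutes_inverses)

lemma label_rel_trancl_increasing:
  assumes "u permutes {1..n}" "(a, b) \<in> (label_rel n w u)\<^sup>+"
  shows "inv' u a < inv' u b"
  using assms(2) by (induction rule: trancl_induct)
    (use label_rel_increasing[OF assms(1)] less_trans in blast)+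

lemma label_rel_bounds:
  assumes "u permutes {1..n}" "(a, b) \<in> label_rel n w u"
  shows "a \<in> {1..n}" "b \<in> {1..n}"
proof -
  obtain j k where "a = u j" "b = u k" "1 \<le> j" "j < k" "k \<le> n"
    using assms(2) by (rule label_relE)
  then show "a \<in> {1..n}" "b \<in> {1..n}"
    using permutes_in_image[OF assms(1), of j] permutes_in_image[OF assms(1), of k] by simp_all
qed

lemma label_rel_inversion:
  assumes "u permutes {1..n}" "bruhat_le n u w" "1 \<le> j" "j < k" "k \<le> n" "u k < u j"
  shows "(u j, u k) \<in> label_rel n w u"
proof (rule label_relI)
  have "bruhat_le n (u \<circ> swap j k) (u \<circ> swap j k \<circ> swap j k)"
    using refl_step_imp_bruhat_le[of "u \<circ> swap j k" n j k] comp_swap_permutes[of u n j k] assms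
    by simp
  then show "bruhat_le n (u \<circ> swap j k) w" using assms(2) by (simp add: rtranclp_trans)
qed (use assms in auto)

text \<open>
  The position of the intermediate label \<open>c\<close> decides: outside \<open>j..k\<close> it forms an inversion with
  \<open>a\<close> or with \<open>b\<close>, and between them it splits the reflection into smaller ones that are also
  below \<open>w\<close>.
\<close>

lemma label_rel_between:
  assumes u: "u permutes {1..n}" "bruhat_le n u w"
    and ab: "(a, b) \<in> label_rel n w u" and c: "a < c" "c < b"
  shows "(c, a) \<in> label_rel n w u \<or> (b, c) \<in> label_rel n w u \<or>
    (a, c) \<in> label_rel n w u \<and> (c, b) \<in> label_rel n w u"
proof -
  obtain j k where jk: "a = u j" "b = u k" "1 \<le> j" "j < k" "k \<le> n"
    and le: "bruhat_le n (u \<circ> swap j k) w" using ab by (rule label_relE)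
  have "c \<in> {1..n}" using label_rel_bounds[OF u(1) ab] c by auto
  then obtain l where l: "1 \<le> l" "l \<le> n" "u l = c" by (rule permutes_position[OF u(1)])
  have "l \<noteq> j" "l \<noteq> k" using l(3) jk c by auto
  then consider "l < j" | "k < l" | "j < l" "l < k" by linarith
  then show ?thesis
  proof cases
    case 1
    then show ?thesis using label_rel_inversion[OF u, of l j] l jk c by auto
  next
    case 2
    then show ?thesis using label_rel_inversion[OF u, of k l] l jk c by auto
  next
    case 3
    have perm: "x \<circ> swap j k permutes {1..n}" "x \<circ> swap j l permutes {1..n}"
        "x \<circ> swap l k permutes {1..n}" if "x permutes {1..n}" for x
      using comp_swap_permutes[OF that] jk l 3 by auto
    have vals: "u j < u l" "u l < u k" using l jk c by auto
    \<comment> \<open>The values at \<open>j < l < k\<close> run through 213, 312, 321 and through 132, 231, 321.\<close>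
    define x1 x2 y1 y2 where "x1 = u \<circ> swap j l" and "x2 = x1 \<circ> swap j k"
      and "y1 = u \<circ> swap l k" and "y2 = y1 \<circ> swap j k"
    note defs = x1_def x2_def y1_def y2_def
    have perms: "x1 permutes {1..n}" "x2 permutes {1..n}" "y1 permutes {1..n}" "y2 permutes {1..n}"
      unfolding defs using perm u(1) by blast+
    have at: "x1 j = u l" "x1 l = u j" "x1 k = u k" "x2 j = u k" "x2 l = u j" "x2 k = u l"
      "y1 j = u j" "y1 l = u k" "y1 k = u l" "y2 j = u l" "y2 l = u k" "y2 k = u j"
      using 3 by (simp_all add: defs)
    have "bruhat_le n x1 x2" "bruhat_le n y1 y2"
      unfolding x2_def y2_def
      using refl_step_imp_bruhat_le[OF perms(1) jk(3-5)] refl_step_imp_bruhat_le[OF perms(3) jk(3-5)]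
        at vals by simp_all
    moreover have "bruhat_le n x2 (x2 \<circ> swap l k)" "bruhat_le n y2 (y2 \<circ> swap j l)"
      using refl_step_imp_bruhat_le[OF perms(2) l(1) 3(2) jk(5)]
        refl_step_imp_bruhat_le[OF perms(4) jk(3) 3(1) l(2)] at vals by simp_all
    moreover have "x2 \<circ> swap l k = u \<circ> swap j k" "y2 \<circ> swap j l = u \<circ> swap j k"
    proof -
      have "(x2 \<circ> swap l k) m = (u \<circ> swap j k) m \<and> (y2 \<circ> swap j l) m = (u \<circ> swap j k) m" for m
      proof -
        consider "m = j" | "m = l" | "m = k" | "m \<noteq> j" "m \<noteq> l" "m \<noteq> k" by blast
        then show ?thesis using 3 by cases (simp_all add: defs)
      qed
      then show "x2 \<circ> swap l k = u \<circ> swap j k" "y2 \<circ> swap j l = u \<circ> swap j k" by auto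
    qed
    ultimately have "bruhat_le n x1 w" "bruhat_le n y1 w"
      using le by (metis rtranclp_trans)+
    then have "(u j, u l) \<in> label_rel n w u" "(u l, u k) \<in> label_rel n w u"
      unfolding defs using label_relI jk l 3 by blast+
    then show ?thesis using jk l by simp
  qed
qed

text \<open>
  The same alternative for the transitive closure. The second and third cases keep the
  intermediate element because the analysis of an edge needs more than the comparison itself.
\<close>

lemma label_rel_trancl_between:
  assumes u: "u permutes {1..n}" "bruhat_le n u w"
    and ab: "(a, b) \<in> (label_rel n w u)\<^sup>+" and c: "a < c" "c < b"
  shows "(a, c) \<in> (label_rel n w u)\<^sup>+ \<and> (c, b) \<in> (label_rel n w u)\<^sup>+ \<or>
    (\<exists>x. (c, x) \<in> (label_rel n w u)\<^sup>+ \<and> (x, b) \<in> (label_rel n w u)\<^sup>+) \<or>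
    (\<exists>y. (a, y) \<in> (label_rel n w u)\<^sup>+ \<and> (y, c) \<in> (label_rel n w u)\<^sup>+)"
  using ab c
proof (induction rule: trancl_induct)
  case (base b)
  then show ?case using label_rel_between[OF u base(1)] by (blast intro: r_into_trancl')
next
  case (step y z)
  have az: "(a, z) \<in> (label_rel n w u)\<^sup>+" using step.hyps by (rule trancl_into_trancl)
  consider "y = c" | "y < c" | "c < y" by linarith
  then show ?case
  proof cases
    case 1
    then show ?thesis using step.hyps by blast
  next
    case 2
    then show ?thesis
      using label_rel_between[OF u step.hyps(2) 2 step.prems(2)] step.hyps az
      by (blast intro: r_into_trancl' trancl_into_trancl)
  next
    case 3
    then show ?thesis
      using step.IH[OF step.prems(1) 3] step.hyps(2) by (blast intro: trancl_into_trancl)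
  qed
qed

lemma label_rel_trancl_cotrans:
  assumes "u permutes {1..n}" "bruhat_le n u w"
    and "(a, b) \<in> (label_rel n w u)\<^sup>+" "a < c" "c < b"
  shows "(a, c) \<in> (label_rel n w u)\<^sup>+ \<or> (c, b) \<in> (label_rel n w u)\<^sup>+"
  using label_rel_trancl_between[OF assms] by (blast intro: trancl_trans)

section \<open>Permutations with prescribed inversions\<close>

text \<open>
  A relation on pairs \<open>a < b\<close> which together with its complement is transitive is an inversion
  set: reversing exactly the pairs in it gives a total order, whose rank function is the
  permutation.
\<close>

lemma exists_permutation_with_inversions:
  fixes R :: "nat \<Rightarrow> nat \<Rightarrow> bool"
  assumes trans: "\<And>a b c. a < b \<Longrightarrow> b < c \<Longrightarrow> R a b \<Longrightarrow> R b c \<Longrightarrow> R a c"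
    and cotrans: "\<And>a b c. a < b \<Longrightarrow> b < c \<Longrightarrow> R a c \<Longrightarrow> R a b \<or> R b c"
  obtains d where "d permutes {1..n}"
    and "\<And>a b. a \<in> {1..n} \<Longrightarrow> b \<in> {1..n} \<Longrightarrow> a < b \<Longrightarrow> d b < d a \<longleftrightarrow> R a b"
proof -
  define L where "L a b \<longleftrightarrow> (if a < b then \<not> R a b else b < a \<and> R b a)" for a b
  have total: "L a b \<longleftrightarrow> \<not> L b a" if "a \<noteq> b" for a b
    using that by (auto simp: L_def)
  have irrefl: "\<not> L a a" for a by (simp add: L_def)
  have L_trans: "L a c" if "L a b" "L b c" for a b c
  proof -
    have "a \<noteq> b" "b \<noteq> c" "a \<noteq> c" using that irrefl total by metis+
    then consider "a < b" "b < c" | "a < c" "c < b" | "b < a" "a < c" | "b < c" "c < a"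
      | "c < a" "a < b" | "c < b" "b < a" by linarith
    then show ?thesis
      using that cotrans[of a b c] trans[of a c b] trans[of b a c] cotrans[of b c a]
        cotrans[of c a b] trans[of c b a]
      by cases (auto simp: L_def)
  qed
  define d where "d a = (if a \<in> {1..n} then Suc (card {x \<in> {1..n}. L x a}) else a)" for a
  have less: "d a < d b" if "a \<in> {1..n}" "b \<in> {1..n}" "L a b" for a b
  proof -
    have "{x \<in> {1..n}. L x a} \<subset> {x \<in> {1..n}. L x b}"
      using that L_trans irrefl by blast
    then have "card {x \<in> {1..n}. L x a} < card {x \<in> {1..n}. L x b}"
      by (intro psubset_card_mono) auto
    then show ?thesis using that by (simp add: d_def)
  qed
  have inj: "inj_on d {1..n}"
    using less total by (intro inj_onI) (metis less_irrefl)
  have "d ` {1..n} \<subseteq> {1..n}"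
  proof clarify
    fix a assume a: "a \<in> {1..n}"
    have "{x \<in> {1..n}. L x a} \<subset> {1..n}" using a irrefl by blast
    then have "card {x \<in> {1..n}. L x a} < card {1..n}" by (intro psubset_card_mono) auto
    then show "d a \<in> {1..n}" using a by (simp add: d_def)
  qed
  then have "bij_betw d {1..n} {1..n}"
    using inj by (simp add: bij_betw_def endo_inj_surj)
  then have "d permutes {1..n}"
    by (rule bij_imp_permutes) (auto simp: d_def)
  moreover have "d b < d a \<longleftrightarrow> R a b" if "a \<in> {1..n}" "b \<in> {1..n}" "a < b" for a b
  proof (cases "R a b")
    case True
    then have "L b a" using that(3) by (simp add: L_def)
    then show ?thesis using less[OF that(2,1)] True by simp
  next
    case False
    then have "L a b" using that(3) by (simp add: L_def)
    then show ?thesis using less[OF that(1,2)] False by simp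
  qed
  ultimately show thesis by (rule that)
qed

section \<open>Elements of the interval that maximise a functional\<close>

lemma finite_bruhat_below: "w permutes {1..n} \<Longrightarrow> finite {v. bruhat_le n v w}"
  by (rule finite_subset[OF _ finite_permutations[of "{1..n}"]]) (auto intro: bruhat_le_permutes)

lemma exists_optimal:
  assumes "w permutes {1..n}"
  obtains u where "optimal n w c u"
proof -
  let ?S = "{v. bruhat_le n v w}"
  have "finite (pairing n c ` ?S)" "pairing n c ` ?S \<noteq> {}"
    using finite_bruhat_below[OF assms] by auto
  then have "Max (pairing n c ` ?S) \<in> pairing n c ` ?S" by (rule Max_in)
  then obtain u where "bruhat_le n u w" "pairing n c u = Max (pairing n c ` ?S)" by auto
  moreover have "pairing n c v \<le> Max (pairing n c ` ?S)" if "bruhat_le n v w" for v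
    using that finite_bruhat_below[OF assms] by (intro Max_ge) auto
  ultimately have "optimal n w c u" by (simp add: optimal_def)
  then show ?thesis by (rule that)
qed

lemma pairing_add: "pairing n (\<lambda>a. c a + t * d a) v = pairing n c v + t * pairing n d v"
  by (simp add: pairing_def algebra_simps sum.distrib sum_distrib_left)

lemma pairing_indicator:
  assumes "v permutes {1..n}" "y \<in> {1..n}"
  shows "pairing n (\<lambda>a. if a = y then 1 else 0) v = real (inv' v y)"
proof -
  have "pairing n (\<lambda>a. if a = y then 1 else 0) v =
      (\<Sum>j = 1..n. if j = inv' v y then real j else 0)"
    unfolding pairing_def
    by (rule sum.cong) (use assms(1) in \<open>auto simp: permutes_inverses\<close>)
  also have "\<dots> = real (inv' v y)"
    using permutes_in_image[OF permutes_inv[OF assms(1)], of y] assms(2) by simp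
  finally show ?thesis .
qed

text \<open>
  If the inequalities involving the label \<open>y\<close> are strict at \<open>u\<close>, the coefficient of \<open>y\<close> can be
  changed in both directions without losing optimality. A second maximiser must then have the
  same coordinate at \<open>y\<close>.
\<close>

lemma optimal_rigid:
  assumes w: "w permutes {1..n}" and opt: "optimal n w c u"
    and v: "bruhat_le n v w" "pairing n c v = pairing n c u" and y: "y \<in> {1..n}"
    and gap: "\<And>p q. (p, q) \<in> label_rel n w u \<Longrightarrow> p = y \<or> q = y \<Longrightarrow> c p + 1 \<le> c q"
  shows "inv' v y = inv' u y"
proof -
  let ?e = "\<lambda>a. if a = y then 1 else (0::real)"
  have u: "bruhat_le n u w" using opt by (simp add: optimal_def)
  have perm: "u permutes {1..n}" "v permutes {1..n}"
    using bruhat_le_permutes w u v(1) by blast+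
  have mono: "c p \<le> c q" if "(p, q) \<in> label_rel n w u" for p q
    using opt that unfolding optimal_iff_monotone[OF w u] by blast
  have "t * real (inv' v y) \<le> t * real (inv' u y)" if t: "\<bar>t\<bar> \<le> 1" for t
  proof -
    have "optimal n w (\<lambda>a. c a + t * ?e a) u"
      unfolding optimal_iff_monotone[OF w u]
    proof clarify
      fix p q assume pq: "(p, q) \<in> label_rel n w u"
      have "p \<noteq> q" using label_rel_increasing[OF perm(1) pq] by auto
      then show "c p + t * ?e p \<le> c q + t * ?e q"
        using mono[OF pq] gap[OF pq] t by auto
    qed
    then show ?thesis
      using v unfolding optimal_def pairing_add pairing_indicator[OF perm(1) y]
      by (auto simp: pairing_indicator[OF perm(2) y])
  qed
  from this[of 1] this[of "-1"] show ?thesis by simp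
qed

lemma permutes_eqI:
  assumes "u permutes {1..n}" "v permutes {1..n}" "\<And>y. y \<in> {1..n} \<Longrightarrow> inv' v y = inv' u y"
  shows "v = u"
proof -
  have "inv' v y = inv' u y" for y
    using assms permutes_not_in[OF permutes_inv[OF assms(1)]]
      permutes_not_in[OF permutes_inv[OF assms(2)]] by (cases "y \<in> {1..n}") simp_all
  then have "inv' v = inv' u" by blast
  then show ?thesis using permutes_inv_inv assms(1,2) by metis
qed

lemma permutes_eq_or_swap:
  assumes f: "f permutes S" and g: "g permutes S"
    and eq: "\<And>y. y \<noteq> a \<Longrightarrow> y \<noteq> b \<Longrightarrow> f y = g y"
  shows "f = g \<or> f = g \<circ> Transposition.transpose a b"
proof -
  have ex: "f x = g a \<or> f x = g b" if "x = a \<or> x = b" for x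
  proof -
    have gx: "g (inv' g (f x)) = f x" by (simp add: permutes_inverses[OF g])
    show ?thesis
    proof (rule ccontr)
      assume neg: "\<not> ?thesis"
      then have "inv' g (f x) \<noteq> a" "inv' g (f x) \<noteq> b" using gx by auto
      then have "f (inv' g (f x)) = f x" using eq gx by simp
      then have "inv' g (f x) = x" using permutes_inj[OF f] by (simp add: inj_eq)
      then show False using gx neg eq that by auto
    qed
  qed
  have "f a = f b \<longleftrightarrow> a = b" using permutes_inj[OF f] by (simp add: inj_eq)
  then consider "f a = g a" "f b = g b" | "f a = g b" "f b = g a"
    using ex[of a] ex[of b] by metis
  then show ?thesis
  proof cases
    case 1
    then have "f y = g y" for y using eq by (cases "y = a"; cases "y = b") auto
    then show ?thesis by blast
  next
    case 2
    then have "f y = (g \<circ> Transposition.transpose a b) y" for y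
      using eq by (cases "y = a"; cases "y = b") auto
    then show ?thesis by blast
  qed
qed

section \<open>Edges from functionals with two maximisers\<close>

definition coord_vec :: "(nat \<Rightarrow> real) \<Rightarrow> (real, 'n::{finite,linorder}) vec"
  where "coord_vec c = (\<chi> i. c (pos i))"

lemma perm_vec_component:
  "u permutes {1..CARD('n)} \<Longrightarrow> (perm_vec u :: (real, 'n::{finite,linorder}) vec) $ i = real (inv' u (pos i))"
  by (simp add: perm_vec_def sym_group_carrier)

lemma coord_vec_inner_perm_vec:
  assumes "u permutes {1..CARD('n)}"
  shows "(coord_vec c :: (real, 'n::{finite,linorder}) vec) \<bullet> perm_vec u = pairing CARD('n) c u"
proof -
  have "(coord_vec c :: (real, 'n) vec) \<bullet> perm_vec u = (\<Sum>i\<in>UNIV. c (pos (i::'n)) * real (inv' u (pos i)))"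
    by (simp add: inner_vec_def coord_vec_def perm_vec_component[OF assms])
  also have "\<dots> = (\<Sum>a = 1..CARD('n). c a * real (inv' u a))"
    by (rule sum.reindex_bij_betw[OF bij_betw_pos])
  also have "\<dots> = (\<Sum>j = 1..CARD('n). c (u j) * real (inv' u (u j)))"
    by (rule sum.reindex_bij_betw[OF permutes_imp_bij[OF assms], symmetric])
  finally show ?thesis by (simp add: pairing_def permutes_inverses[OF assms])
qed

lemma coord_vec_surj:
  obtains c where "A = (coord_vec c :: (real, 'n::{finite,linorder}) vec)"
proof
  show "A = coord_vec (\<lambda>a. A $ inv' pos a)"
    using bij_betw_imp_inj_on[OF bij_betw_pos[where 'n = 'n]]
    by (simp add: coord_vec_def vec_eq_iff)
qed

lemma perm_vec_eq_iff:
  assumes "u permutes {1..CARD('n)}" "v permutes {1..CARD('n)}"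
  shows "(perm_vec u :: (real, 'n::{finite,linorder}) vec) = perm_vec v \<longleftrightarrow> u = v"
proof
  assume eq: "(perm_vec u :: (real, 'n) vec) = perm_vec v"
  have "inv' u y = inv' v y" if "y \<in> {1..CARD('n)}" for y
  proof -
    have "y \<in> range (pos :: 'n \<Rightarrow> nat)"
      using that bij_betw_imp_surj_on[OF bij_betw_pos[where 'n = 'n]] by simp
    then obtain i :: 'n where "y = pos i" by (rule rangeE)
    then show ?thesis
      using eq perm_vec_component[OF assms(1), of i] perm_vec_component[OF assms(2), of i] by simp
  qed
  then show "u = v" using permutes_eqI[OF assms(2,1)] by blast
qed simp

lemma norm_perm_vec:
  assumes "u permutes {1..CARD('n)}"
  shows "norm (perm_vec u :: (real, 'n::{finite,linorder}) vec) = sqrt (\<Sum>j = 1..CARD('n). real j * real j)"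
proof -
  have "(perm_vec u :: (real, 'n) vec) = coord_vec (\<lambda>a. real (inv' u a))"
    by (simp add: vec_eq_iff coord_vec_def perm_vec_component[OF assms])
  then have "(perm_vec u :: (real, 'n) vec) \<bullet> perm_vec u = pairing CARD('n) (\<lambda>a. real (inv' u a)) u"
    using coord_vec_inner_perm_vec[OF assms] by metis
  then show ?thesis
    by (simp add: norm_eq_sqrt_inner pairing_def permutes_inverses[OF assms])
qed

text \<open>All vertices lie on a sphere, so none lies between two others.\<close>

lemma perm_vec_in_segment:
  assumes perm: "u permutes {1..CARD('n)}" "v permutes {1..CARD('n)}" "z permutes {1..CARD('n)}"
    and "(perm_vec z :: (real, 'n::{finite,linorder}) vec) \<in> closed_segment (perm_vec u) (perm_vec v)"
  shows "z = u \<or> z = v"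
proof -
  have "(perm_vec z :: (real, 'n) vec) \<notin> open_segment (perm_vec u) (perm_vec v)"
    using different_norm_3_collinear_points norm_perm_vec[OF perm(1)] norm_perm_vec[OF perm(2)]
      norm_perm_vec[OF perm(3)] by metis
  then have "(perm_vec z :: (real, 'n) vec) = perm_vec u \<or> (perm_vec z :: (real, 'n) vec) = perm_vec v"
    using assms(4) by (auto simp: open_segment_def)
  then show ?thesis using perm_vec_eq_iff perm by blast
qed

lemma finite_perm_vecs:
  "w permutes {1..CARD('n)} \<Longrightarrow>
    finite (perm_vec ` bruhat_ideal CARD('n) w :: ((real, 'n::{finite,linorder}) vec) set)"
  using finite_bruhat_below[of w "CARD('n)"] by (simp add: bruhat_ideal_iff Collect_mem_eq set_eq_iff
    bruhat_ideal_def sym_group_carrier)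

text \<open>
  The face on which a functional is maximal is the convex hull of the maximising vertices, hence
  a segment if there are exactly two of them.
\<close>

lemma skeleton_coverI:
  fixes c :: "nat \<Rightarrow> real"
  assumes w: "w permutes {1..CARD('n::{finite,linorder})}"
    and opt: "optimal CARD('n) w c u" "optimal CARD('n) w c u'" and "u \<noteq> u'"
    and only: "\<And>v. optimal CARD('n) w c v \<Longrightarrow> v = u \<or> v = u'"
    and len: "coxeter_length CARD('n) u < coxeter_length CARD('n) u'"
  shows "skeleton_cover TYPE('n) w u u'"
proof -
  let ?n = "CARD('n)" and ?Q = "bruhat_interval_polytope w :: ((real, 'n) vec) set"
  define M where "M = pairing ?n c u"
  define S where "S = (perm_vec ` bruhat_ideal ?n w :: ((real, 'n) vec) set)"
  have M: "pairing ?n c u' = M" using opt by (auto simp: M_def optimal_def intro: antisym)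
  have below: "bruhat_le ?n u w" "bruhat_le ?n u' w" using opt by (auto simp: optimal_def)
  have perm: "z permutes {1..?n}" if "bruhat_le ?n z w" for z
    using bruhat_le_permutes[OF that w] .
  have inS: "perm_vec z \<in> S" if "bruhat_le ?n z w" for z
    using that by (simp add: S_def bruhat_ideal_iff[OF w])
  have Q: "?Q = convex hull S" by (simp add: bruhat_interval_polytope_def S_def)
  have le: "x \<in> ?Q \<Longrightarrow> coord_vec c \<bullet> x \<le> M" for x
  proof -
    have "S \<subseteq> {x. coord_vec c \<bullet> x \<le> M}"
      using opt(1) coord_vec_inner_perm_vec[OF perm]
      by (auto simp: S_def M_def optimal_def bruhat_ideal_iff[OF w])
    then have "?Q \<subseteq> {x. coord_vec c \<bullet> x \<le> M}"
      unfolding Q by (rule hull_minimal) (rule convex_halfspace_le)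
    then show "x \<in> ?Q \<Longrightarrow> coord_vec c \<bullet> x \<le> M" by blast
  qed
  define T where "T = ?Q \<inter> {x. coord_vec c \<bullet> x = M}"
  have face: "T face_of ?Q"
    unfolding T_def by (rule face_of_Int_supporting_hyperplane_le) (use le Q in auto)
  have ends: "perm_vec u \<in> T" "perm_vec u' \<in> T"
    using inS below coord_vec_inner_perm_vec[OF perm] M
    by (auto simp: T_def Q M_def intro: hull_inc)
  have "T = closed_segment (perm_vec u) (perm_vec u')"
  proof
    obtain S' where S': "S' \<subseteq> S" "T = convex hull S'"
      using face_of_convex_hull_subset[of S T] face finite_perm_vecs[OF w]
      unfolding Q S_def by (metis finite_imp_compact)
    have "x = perm_vec u \<or> x = perm_vec u'" if xS: "x \<in> S'" for x
    proof -
      obtain v where v: "bruhat_le ?n v w" "x = perm_vec v"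
        using subsetD[OF S'(1) xS] unfolding S_def bruhat_ideal_iff[OF w, symmetric] by blast
      have "x \<in> T" using xS S'(2) by (simp add: hull_inc)
      then have "pairing ?n c v = M"
        using v coord_vec_inner_perm_vec[OF perm] by (auto simp: T_def)
      then have "optimal ?n w c v" using opt(1) v(1) by (simp add: optimal_def M_def)
      then show ?thesis using only v by blast
    qed
    then show "T \<subseteq> closed_segment (perm_vec u) (perm_vec u')"
      unfolding S'(2) segment_convex_hull by (intro hull_mono) blast
    show "closed_segment (perm_vec u) (perm_vec u') \<subseteq> T"
      using ends face_of_imp_convex[OF face] by (rule closed_segment_subset)
  qed
  moreover have "aff_dim (closed_segment (perm_vec u) (perm_vec u' :: (real, 'n) vec)) = 1"
    using perm_vec_eq_iff[OF perm[OF below(1)] perm[OF below(2)]] \<open>u \<noteq> u'\<close>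
    by (simp add: segment_convex_hull aff_dim_convex_hull aff_dim_2)
  ultimately show ?thesis
    using face len below by (simp add: skeleton_cover_def edge_of_def bruhat_ideal_iff[OF w])
qed

section \<open>From weak order to the skeleton\<close>

lemma optimal_permutation_strict:
  assumes w: "w permutes {1..n}" and c: "c permutes {1..n}"
    and opt: "optimal n w (\<lambda>a. real (c a)) u" and pq: "(p, q) \<in> label_rel n w u"
  shows "c p < c q"
proof -
  have u: "bruhat_le n u w" using opt by (simp add: optimal_def)
  have "real (c p) \<le> real (c q)"
    using opt pq unfolding optimal_iff_monotone[OF w u] by blast
  moreover have "p \<noteq> q"
    using label_rel_increasing[OF bruhat_le_permutes[OF u w] pq] by auto
  ultimately show ?thesis using permutes_apply_eq_iff[OF c, of p q] by simp
qed

text \<open>All inequalities at \<open>u\<close> hold with a gap of at least 1, as \<open>c\<close> has distinct integer values.\<close>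

lemma optimal_permutation_unique:
  assumes w: "w permutes {1..n}" and c: "c permutes {1..n}"
    and opt: "optimal n w (\<lambda>a. real (c a)) u" "optimal n w (\<lambda>a. real (c a)) v"
  shows "v = u"
proof (rule permutes_eqI)
  have below: "bruhat_le n u w" "bruhat_le n v w" using opt by (auto simp: optimal_def)
  show "u permutes {1..n}" "v permutes {1..n}" using below bruhat_le_permutes w by blast+
  have eq: "pairing n (\<lambda>a. real (c a)) v = pairing n (\<lambda>a. real (c a)) u"
    using opt below by (auto simp: optimal_def intro: antisym)
  fix y assume "y \<in> {1..n}"
  then show "inv' v y = inv' u y"
    using optimal_rigid[OF w opt(1) below(2) eq] optimal_permutation_strict[OF w c opt(1)]
    by (metis Suc_leI of_nat_Suc of_nat_le_iff add.commute)
qed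

text \<open>
  Crossing a single wall of the braid arrangement either stays in the normal cone of a vertex or
  follows one edge, because on the wall only the labels \<open>a\<close> and \<open>b\<close> are tied. The edge leads
  upwards as the wall is crossed in the direction that creates the inversion \<open>(a, b)\<close>.
\<close>

lemma skeleton_step_of_adjacent:
  assumes w: "w permutes {1..CARD('n::{finite,linorder})}" and c: "c permutes {1..CARD('n)}"
    and ab: "1 \<le> a" "a < b" "b \<le> CARD('n)" "c a = i" "c b = Suc i"
    and opt: "optimal CARD('n) w (\<lambda>x. real (c x)) u"
    and opt': "optimal CARD('n) w (\<lambda>x. real (adj_swap i (c x))) u'"
  shows "u = u' \<or> skeleton_cover TYPE('n) w u u'"
proof (cases "u = u'")
  case False
  let ?n = "CARD('n)"
  define c' where "c' x = adj_swap i (c x)" for x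
  \<comment> \<open>Up to a factor 2, this is the point where the segment from \<open>c\<close> to \<open>c'\<close> crosses the
    hyperplane on which the coordinates \<open>a\<close> and \<open>b\<close> agree.\<close>
  define c0 where "c0 x = real (c x) + real (c' x)" for x
  have i: "1 \<le> i" "i < ?n"
    using permutes_in_image[OF c, of a] permutes_in_image[OF c, of b] ab by auto
  have c'_perm: "c' permutes {1..?n}"
    using adj_swap_comp_permutes[OF c i] by (simp add: c'_def[abs_def] comp_def)
  have c'_ab: "c' a = Suc i" "c' b = i" using ab by (auto simp: c'_def)
  have tie: "c0 a = c0 b" using c'_ab ab by (simp add: c0_def)
  have inj: "c x = c y \<longleftrightarrow> x = y" for x y using permutes_apply_eq_iff[OF c] .
  have cmp: "c' y < c' x \<longleftrightarrow> c y < c x" if "{x, y} \<noteq> {a, b}" for x y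
    unfolding c'_def
  proof (rule adj_swap_less_iff)
    have "c ` {x, y} \<noteq> c ` {a, b}"
      unfolding inj_image_eq_iff[OF permutes_inj[OF c]] by (rule that)
    then show "{c x, c y} \<noteq> {i, Suc i}" using ab by simp
  qed
  have below: "bruhat_le ?n u w" "bruhat_le ?n u' w" using opt opt' by (auto simp: optimal_def)
  have perm: "u permutes {1..?n}" "u' permutes {1..?n}" using below bruhat_le_permutes w by blast+
  have less: "c p < c q" if "(p, q) \<in> label_rel ?n w u" for p q
    using optimal_permutation_strict[OF w c opt that] .
  have less': "c' p < c' q" if "(p, q) \<in> label_rel ?n w u'" for p q
    using optimal_permutation_strict[OF w c'_perm opt'[folded c'_def] that] .
  have gap: "c0 p + 1 \<le> c0 q" if "c p < c q" "{p, q} \<noteq> {a, b}" for p q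
  proof -
    have "c' p < c' q" using cmp[of q p] that by (simp add: insert_commute)
    then show ?thesis using that(1) by (simp add: c0_def)
  qed
  have tie': "c0 p = c0 q" if "{p, q} = {a, b}" for p q
    using that tie by (auto simp: doubleton_eq_iff)
  have opt0: "optimal ?n w c0 u"
    unfolding optimal_iff_monotone[OF w below(1)]
  proof clarify
    fix p q assume "(p, q) \<in> label_rel ?n w u"
    from less[OF this] show "c0 p \<le> c0 q"
      using gap[of p q] tie'[of p q] by (cases "{p, q} = {a, b}") auto
  qed
  have opt0': "optimal ?n w c0 u'"
    unfolding optimal_iff_monotone[OF w below(2)]
  proof clarify
    fix p q assume "(p, q) \<in> label_rel ?n w u'"
    from less'[OF this] show "c0 p \<le> c0 q"
      using cmp[of q p] gap[of p q] tie'[of p q]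
      by (cases "{p, q} = {a, b}") (auto simp: insert_commute)
  qed
  define v where "v = swap a b \<circ> u"
  have dich: "z = u \<or> z = v" if "optimal ?n w c0 z" for z
  proof -
    have z: "bruhat_le ?n z w" using that by (simp add: optimal_def)
    have zp: "z permutes {1..?n}" using bruhat_le_permutes[OF z w] .
    have eq: "pairing ?n c0 z = pairing ?n c0 u"
      using that opt0 by (auto simp: optimal_def intro: antisym)
    have "inv' z y = inv' u y" if "y \<noteq> a" "y \<noteq> b" for y
    proof (cases "y \<in> {1..?n}")
      case True
      show ?thesis
        by (rule optimal_rigid[OF w opt0 z eq True]) (use gap less that in blast)
    next
      case False
      then show ?thesis
        using permutes_not_in[OF permutes_inv[OF zp]] permutes_not_in[OF permutes_inv[OF perm(1)]]
        by simp
    qed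
    then have "inv' z = inv' u \<or> inv' z = inv' u \<circ> swap a b"
      by (rule permutes_eq_or_swap[OF permutes_inv[OF zp] permutes_inv[OF perm(1)]])
    moreover have "inv' u \<circ> swap a b = inv' v"
      unfolding v_def using permutes_bij[OF perm(1)] by (simp add: o_inv_distrib)
    moreover have "v permutes {1..?n}"
      unfolding v_def using perm(1) ab by (intro permutes_compose swap_permutes) auto
    ultimately show ?thesis using permutes_inv_inv zp perm(1) by metis
  qed
  have u'v: "u' = v" using dich[OF opt0'] False by simp
  obtain j where j: "1 \<le> j" "j \<le> ?n" "u j = a"
    using permutes_position[OF perm(1), of a] ab by auto
  obtain k where k: "1 \<le> k" "k \<le> ?n" "u k = b"
    using permutes_position[OF perm(1), of b] ab by auto
  have u': "u' = u \<circ> swap j k"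
    unfolding u'v v_def using transpose_comp_eq[OF permutes_bij[OF perm(1)], of a b] j(3) k(3)
      permutes_inverses(2)[OF perm(1)] by metis
  have opt_le: "pairing ?n (\<lambda>x. real (c x)) u' \<le> pairing ?n (\<lambda>x. real (c x)) u"
    using opt below(2) by (simp add: optimal_def)
  have "j < k"
  proof (rule ccontr)
    assume "\<not> j < k"
    then have kj: "k < j" using j k ab by (metis less_irrefl linorder_neqE_nat)
    have "u' = u \<circ> swap k j" using u' by (simp add: transpose_commute)
    then show False
      using opt_le pairing_swap[OF k(1) kj j(2), of "\<lambda>x. real (c x)" u] j k ab kj by simp
  qed
  then have "refl_step ?n u u'"
    unfolding refl_step_def using perm(1) j k ab u' by blast
  then have "coxeter_length ?n u < coxeter_length ?n u'" by (rule refl_step_length)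
  then have "skeleton_cover TYPE('n) w u u'"
    using skeleton_coverI[OF w opt0 opt0' False] dich u'v by blast
  then show ?thesis ..
qed simp

text \<open>
  Containment of inversion sets is the weak order on the chambers of the braid arrangement. As
  long as \<open>c \<noteq> d\<close>, some two adjacent values of \<open>c\<close> are ordered differently by \<open>d\<close>; exchanging
  them adds one inversion, and the maximiser moves up in the skeleton or stays put.
\<close>

lemma skeleton_le_of_inversions:
  assumes w: "w permutes {1..CARD('n::{finite,linorder})}"
    and d: "d permutes {1..CARD('n)}" "optimal CARD('n) w (\<lambda>x. real (d x)) v"
    and c: "c permutes {1..CARD('n)}" "optimal CARD('n) w (\<lambda>x. real (c x)) u"
    and sub: "inversions CARD('n) c \<subseteq> inversions CARD('n) d"
  shows "(skeleton_cover TYPE('n) w)\<^sup>*\<^sup>* u v"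
  using c sub
proof (induction "card (inversions CARD('n) d) - card (inversions CARD('n) c)"
    arbitrary: c u rule: less_induct)
  case less
  let ?n = "CARD('n)"
  note c = less.prems(1)
  show ?case
  proof (cases "d \<circ> inv' c = id")
    case True
    have "d x = c x" for x
      using fun_cong[OF True, of "c x"] by (simp add: permutes_inverses[OF c])
    then have "d = c" by blast
    then show ?thesis
      using optimal_permutation_unique[OF w d] less.prems(2) by blast
  next
    case False
    have "d \<circ> inv' c permutes {1..?n}" using d(1) c by (intro permutes_compose permutes_inv)
    then obtain i where i: "1 \<le> i" "i < ?n" and not: "\<not> d (inv' c i) < d (inv' c (Suc i))"
      using permutes_ascending_imp_id[of "d \<circ> inv' c" ?n] False by auto
    define a b where "a = inv' c i" and "b = inv' c (Suc i)"
    have ab: "a \<in> {1..?n}" "b \<in> {1..?n}" "c a = i" "c b = Suc i"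
      using permutes_in_image[OF permutes_inv[OF c], of i] i
        permutes_in_image[OF permutes_inv[OF c], of "Suc i"]
      by (auto simp: a_def b_def permutes_inverses[OF c])
    have "a \<noteq> b" using ab by auto
    then have dab: "d b < d a"
      using not permutes_apply_eq_iff[OF d(1), of a b] by (simp add: a_def b_def)
    have "\<not> b < a"
    proof
      assume "b < a"
      then have "(b, a) \<in> inversions ?n c" using ab by (simp add: inversions_def)
      then have "(b, a) \<in> inversions ?n d" using less.prems(3) by blast
      then show False using dab by (simp add: inversions_def)
    qed
    then have "a < b" using \<open>a \<noteq> b\<close> by simp
    define c' where "c' = adj_swap i \<circ> c"
    have c': "c' permutes {1..?n}" unfolding c'_def by (rule adj_swap_comp_permutes[OF c i])
    have inv: "inversions ?n c' = insert (a, b) (inversions ?n c)" "(a, b) \<notin> inversions ?n c"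
      unfolding c'_def using inversions_adj_swap[of c ?n a b i] c ab \<open>a < b\<close> by auto
    have "(a, b) \<in> inversions ?n d" using ab dab \<open>a < b\<close> by (simp add: inversions_def)
    then have sub': "inversions ?n c' \<subseteq> inversions ?n d" using inv less.prems(3) by simp
    then have "card (inversions ?n c') \<le> card (inversions ?n d)" by (intro card_mono) simp
    moreover have "card (inversions ?n c') = Suc (card (inversions ?n c))" using inv by simp
    ultimately have dec: "card (inversions ?n d) - card (inversions ?n c') <
        card (inversions ?n d) - card (inversions ?n c)" by simp
    obtain u' where u': "optimal ?n w (\<lambda>x. real (c' x)) u'" using exists_optimal[OF w] .
    have "u = u' \<or> skeleton_cover TYPE('n) w u u'"
      by (rule skeleton_step_of_adjacent[OF w c, of a b i])
        (use ab \<open>a < b\<close> less.prems(2) u' in \<open>simp_all add: c'_def\<close>)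
    moreover have "(skeleton_cover TYPE('n) w)\<^sup>*\<^sup>* u' v" by (rule less.hyps[OF dec c' u' sub'])
    ultimately show ?thesis by (blast intro: converse_rtranclp_into_rtranclp)
  qed
qed

section \<open>The coordinate orders at the two ends of an edge\<close>

text \<open>Faces of polytopes are exposed.\<close>

lemma skeleton_cover_functional:
  assumes w: "w permutes {1..CARD('n::{finite,linorder})}" and uv: "skeleton_cover TYPE('n) w u v"
  obtains c where "optimal CARD('n) w c u"
    and "\<And>z. optimal CARD('n) w c z \<longleftrightarrow> z = u \<or> z = v"
proof -
  let ?n = "CARD('n)" and ?Q = "bruhat_interval_polytope w :: ((real, 'n) vec) set"
  have below: "bruhat_le ?n u w" "bruhat_le ?n v w"
    using uv by (simp_all add: skeleton_cover_def bruhat_ideal_iff[OF w])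
  have perm: "z permutes {1..?n}" if "bruhat_le ?n z w" for z
    using bruhat_le_permutes[OF that w] .
  have inQ: "(perm_vec z :: (real, 'n) vec) \<in> ?Q" if "bruhat_le ?n z w" for z
    using that by (simp add: bruhat_interval_polytope_def bruhat_ideal_iff[OF w] hull_inc)
  have poly: "polytope ?Q"
    unfolding bruhat_interval_polytope_def polytope_def using finite_perm_vecs[OF w] by blast
  have "closed_segment (perm_vec u) (perm_vec v) exposed_face_of ?Q"
    using uv exposed_face_of_polyhedron[OF polytope_imp_polyhedron[OF poly]]
    by (simp add: skeleton_cover_def edge_of_def)
  then obtain A \<beta> where A: "?Q \<subseteq> {x. A \<bullet> x \<le> \<beta>}"
    "closed_segment (perm_vec u) (perm_vec v) = ?Q \<inter> {x. A \<bullet> x = \<beta>}"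
    unfolding exposed_face_of_def by blast
  obtain c where c: "A = coord_vec c" using coord_vec_surj .
  have pair: "A \<bullet> perm_vec z = pairing ?n c z" if "bruhat_le ?n z w" for z
    unfolding c by (rule coord_vec_inner_perm_vec[OF perm[OF that]])
  have le: "pairing ?n c z \<le> \<beta>" if "bruhat_le ?n z w" for z
    using A(1) inQ[OF that] pair[OF that] by auto
  have "(perm_vec u :: (real, 'n) vec) \<in> ?Q \<inter> {x. A \<bullet> x = \<beta>}"
    "(perm_vec v :: (real, 'n) vec) \<in> ?Q \<inter> {x. A \<bullet> x = \<beta>}"
    unfolding A(2)[symmetric] by simp_all
  then have max: "pairing ?n c u = \<beta>" "pairing ?n c v = \<beta>" using pair below by auto
  have opt: "optimal ?n w c u" "optimal ?n w c v"
    using max le below by (simp_all add: optimal_def)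
  have "z = u \<or> z = v" if "optimal ?n w c z" for z
  proof -
    have z: "bruhat_le ?n z w" using that by (simp add: optimal_def)
    have "pairing ?n c z = \<beta>"
      using that opt(1) max below(1) le[OF z] by (auto simp: optimal_def intro: antisym)
    then have "(perm_vec z :: (real, 'n) vec) \<in> closed_segment (perm_vec u) (perm_vec v)"
      unfolding A(2) using inQ[OF z] pair[OF z] by simp
    then show ?thesis using perm_vec_in_segment perm below z by blast
  qed
  then show thesis using that[of c] opt by blast
qed

text \<open>
  Some pair must be tied under the exposing functional, for otherwise its maximum would be attained
  only at \<open>u\<close>. Every tied pair produces a second maximiser, which can only be \<open>v\<close>, so there
  is exactly one tied pair.
\<close>

lemma skeleton_cover_swap:
  assumes w: "w permutes {1..CARD('n::{finite,linorder})}" and uv: "skeleton_cover TYPE('n) w u v"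
  obtains j k and c :: "nat \<Rightarrow> real" where "1 \<le> j" "j < k" "k \<le> CARD('n)" "u j < u k" "v = u \<circ> swap j k"
    and "c (u j) = c (u k)"
    and "\<And>p q. (p, q) \<in> label_rel CARD('n) w u \<Longrightarrow> c p < c q \<or> p = u j \<and> q = u k"
proof -
  let ?n = "CARD('n)" and ?r = "label_rel CARD('n) w u"
  obtain c where opt: "optimal ?n w c u"
    and only: "\<And>z. optimal ?n w c z \<longleftrightarrow> z = u \<or> z = v"
    by (rule skeleton_cover_functional[OF w uv]) blast
  have below: "bruhat_le ?n u w" "bruhat_le ?n v w"
    using uv by (simp_all add: skeleton_cover_def bruhat_ideal_iff[OF w])
  have perm: "u permutes {1..?n}" "v permutes {1..?n}" using below bruhat_le_permutes w by blast+
  have len: "coxeter_length ?n u < coxeter_length ?n v" using uv by (simp add: skeleton_cover_def)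
  have mono: "c p \<le> c q" if "(p, q) \<in> ?r" for p q
    using opt that unfolding optimal_iff_monotone[OF w below(1)] by blast
  have tie: "v = u \<circ> swap j k"
    if "1 \<le> j" "j < k" "k \<le> ?n" "bruhat_le ?n (u \<circ> swap j k) w" "c (u j) = c (u k)" for j k
  proof -
    have "pairing ?n c (u \<circ> swap j k) = pairing ?n c u"
      using pairing_swap[OF that(1-3), of c u] that(5) by simp
    then have "optimal ?n w c (u \<circ> swap j k)" using opt that(4) by (simp add: optimal_def)
    moreover have "(u \<circ> swap j k) j \<noteq> u j"
      using permutes_apply_eq_iff[OF perm(1), of k j] that(2) by simp
    ultimately show ?thesis using only by metis
  qed
  have "\<exists>(p, q) \<in> ?r. c p = c q"
  proof (rule ccontr)
    assume "\<not> ?thesis"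
    then have strict: "c p < c q" if "(p, q) \<in> ?r" for p q using mono[OF that] that by fastforce
    have fin: "finite ?r"
      by (rule finite_subset[of _ "{1..?n} \<times> {1..?n}"]) (use label_rel_bounds[OF perm(1)] in auto)
    \<comment> \<open>A multiple of \<open>c\<close> has gaps at least 1 on all pairs, so its maximum is attained only
      once.\<close>
    define K where "K = (\<Sum>(p, q) \<in> ?r. 1 / (c q - c p))"
    have K: "1 / (c q - c p) \<le> K" if "(p, q) \<in> ?r" for p q
      unfolding K_def using member_le_sum[OF that, of "\<lambda>(p, q). 1 / (c q - c p)"] fin strict
      by (auto simp: less_imp_le)
    have K0: "0 \<le> K" unfolding K_def using strict by (intro sum_nonneg) (auto simp: less_imp_le)
    let ?c = "\<lambda>a. 0 + K * c a"
    have gap: "?c p + 1 \<le> ?c q" if "(p, q) \<in> ?r" for p q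
      using K[OF that] strict[OF that] by (simp add: divide_le_eq algebra_simps)
    have optK: "optimal ?n w ?c u"
      unfolding optimal_iff_monotone[OF w below(1)] using gap by fastforce
    have "optimal ?n w c v" using only by blast
    then have "pairing ?n c v = pairing ?n c u"
      using opt by (auto simp: optimal_def intro: antisym)
    then have eq: "pairing ?n ?c v = pairing ?n ?c u"
      unfolding pairing_add by (simp add: pairing_def[of n "\<lambda>a. 0" for n])
    have "v = u"
      by (rule permutes_eqI[OF perm], rule optimal_rigid[OF w optK below(2) eq]) (use gap in auto)
    then show False using len by simp
  qed
  then obtain p q where "(p, q) \<in> ?r" "c p = c q" by blast
  then obtain j k where jk: "1 \<le> j" "j < k" "k \<le> ?n" and le: "bruhat_le ?n (u \<circ> swap j k) w"
    and c: "c (u j) = c (u k)" by (metis label_relE)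
  have v: "v = u \<circ> swap j k" by (rule tie[OF jk le c])
  have "u j < u k"
  proof (rule ccontr)
    assume "\<not> u j < u k"
    then have "u k < u j" using permutes_apply_eq_iff[OF perm(1), of j k] jk by simp
    then have "refl_step ?n v (v \<circ> swap j k)"
      unfolding refl_step_def using perm(2) jk v \<open>u k < u j\<close>
      by (intro conjI exI[of _ j] exI[of _ k]) simp_all
    then have "refl_step ?n v u" using v by simp
    then show False using refl_step_length len by fastforce
  qed
  moreover have "c p < c q \<or> p = u j \<and> q = u k" if pq: "(p, q) \<in> ?r" for p q
  proof (rule disjCI)
    assume neq: "\<not> (p = u j \<and> q = u k)"
    obtain j' k' where jk': "p = u j'" "q = u k'" "1 \<le> j'" "j' < k'" "k' \<le> ?n"
      "bruhat_le ?n (u \<circ> swap j' k') w" using pq by (rule label_relE)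
    show "c p < c q"
    proof (rule ccontr)
      assume "\<not> c p < c q"
      then have "c (u j') = c (u k')" using mono[OF pq] jk' by simp
      then have "v = u \<circ> swap j' k'" by (rule tie[OF jk'(3-6)])
      then have "u (swap j k x) = u (swap j' k' x)" for x using v by (metis comp_apply)
      then have same: "swap j k x = swap j' k' x" for x
        using permutes_apply_eq_iff[OF perm(1)] by blast
      have "swap j' k' j = k" "swap j' k' k = j" using same[of j] same[of k] by simp_all
      then have "j = j' \<and> k = k'"
        using jk(2) jk'(4) by (auto simp: Transposition.transpose_def split: if_splits)
      then show False using neq jk' by simp
    qed
  qed
  ultimately show thesis using that[OF jk _ v c] by blast
qed

text \<open>
  The normal cones of \<open>u\<close> and \<open>v\<close> have the same points on the hyperplane on which the labels
  \<open>u j\<close> and \<open>u k\<close> are tied. The relation at \<open>v\<close> therefore holds at \<open>u\<close> once this tie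
  is added: test it on the indicator function of the labels that are reachable from \<open>p\<close>.
\<close>

lemma label_rel_along_edge:
  assumes w: "w permutes {1..n}" and u: "bruhat_le n u w" and jk: "1 \<le> j" "j < k" "k \<le> n"
    and v: "v = u \<circ> swap j k" "bruhat_le n v w"
    and pq: "(p, q) \<in> (label_rel n w v)\<^sup>+"
  shows "(p, q) \<in> (insert (u k, u j) (label_rel n w u))\<^sup>*"
proof -
  let ?R = "insert (u k, u j) (label_rel n w u)"
  have uv: "(u j, u k) \<in> label_rel n w u" using label_relI[OF jk] v by blast
  have "(p, q) \<in> ?R\<^sup>*" if pq: "(p, q) \<in> label_rel n w v" for p q
  proof -
    define c where "c x = (if (p, x) \<in> ?R\<^sup>* then 1 else (0::real))" for x
    have mono: "c x \<le> c y" if "(x, y) \<in> ?R" for x y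
      using rtrancl_into_rtrancl[OF _ that] by (auto simp: c_def)
    have opt: "optimal n w c u"
      unfolding optimal_iff_monotone[OF w u] using mono by blast
    have "c (u j) = c (u k)" using mono[of "u j" "u k"] mono[of "u k" "u j"] uv by simp
    then have "pairing n c v = pairing n c u" unfolding v(1) pairing_swap[OF jk] by simp
    then have "optimal n w c v" using opt v(2) by (simp add: optimal_def)
    then have "c p \<le> c q" using pq unfolding optimal_iff_monotone[OF w v(2)] by blast
    then show ?thesis by (simp add: c_def split: if_splits)
  qed
  then have "label_rel n w v \<subseteq> ?R\<^sup>*" by auto
  then have "(label_rel n w v)\<^sup>+ \<subseteq> ?R\<^sup>*"
    by (metis rtrancl_idemp rtrancl_mono trancl_into_rtrancl subrelI subset_iff)
  then show ?thesis using pq by blast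
qed

text \<open>
  Otherwise \<open>i \<le> b\<close> and \<open>a \<le> i + 1\<close> in the order at \<open>u\<close>, where \<open>a < b\<close> are the labels
  exchanged along the edge. No label lies strictly between \<open>a\<close> and \<open>b\<close> in that order, since the
  exposing functional ties only these two. Inserting \<open>i\<close> or \<open>i + 1\<close> between \<open>a\<close> and \<open>b\<close>, or
  \<open>a\<close> or \<open>b\<close> between \<open>i\<close> and the other end, contradicts this, or the assumption that \<open>i\<close> and
  \<open>i + 1\<close> are unrelated at \<open>u\<close>, in every relative position of the four labels.
\<close>

lemma label_rel_edge_adjacent:
  assumes w: "w permutes {1..CARD('n::{finite,linorder})}" and uv: "skeleton_cover TYPE('n) w u v"
    and i: "(i, Suc i) \<in> (label_rel CARD('n) w v)\<^sup>+"
  shows "(i, Suc i) \<in> (label_rel CARD('n) w u)\<^sup>+"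
proof (rule ccontr)
  let ?n = "CARD('n)"
  define r where "r = (label_rel ?n w u)\<^sup>+"
  assume "(i, Suc i) \<notin> (label_rel ?n w u)\<^sup>+"
  then have no: "(i, Suc i) \<notin> r" by (simp add: r_def)
  obtain j k and c :: "nat \<Rightarrow> real" where jk: "1 \<le> j" "j < k" "k \<le> ?n" "u j < u k" "v = u \<circ> swap j k"
    and tie: "c (u j) = c (u k)"
    and strict: "\<And>p q. (p, q) \<in> label_rel ?n w u \<Longrightarrow> c p < c q \<or> p = u j \<and> q = u k"
    by (rule skeleton_cover_swap[OF w uv]) blast
  define a b where "a = u j" and "b = u k"
  note tie = tie[folded a_def b_def] and strict = strict[folded a_def b_def]
  have below: "bruhat_le ?n u w" "bruhat_le ?n v w"
    using uv by (simp_all add: skeleton_cover_def bruhat_ideal_iff[OF w])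
  have perm: "u permutes {1..?n}" using below bruhat_le_permutes w by blast
  have ab: "a < b" using jk by (simp add: a_def b_def)
  have abr: "(a, b) \<in> r"
    unfolding r_def a_def b_def using label_relI[OF jk(1-3)] jk(5) below(2) by blast
  have trans: "(x, y) \<in> r \<Longrightarrow> (y, z) \<in> r \<Longrightarrow> (x, z) \<in> r" for x y z
    unfolding r_def by (rule trancl_trans)
  have irrefl: "(x, x) \<notin> r" for x
    using label_rel_trancl_increasing[OF perm] unfolding r_def by blast
  have mono1: "c x \<le> c y" if "(x, y) \<in> label_rel ?n w u" for x y
    using strict[OF that] tie by fastforce
  have mono: "c x \<le> c y" if "(x, y) \<in> r" for x y
    using that unfolding r_def by (induction rule: trancl_induct) (auto dest: mono1)
  have cover: "\<not> ((a, x) \<in> r \<and> (x, b) \<in> r)" for x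
  proof
    assume x: "(a, x) \<in> r \<and> (x, b) \<in> r"
    then obtain y where y: "(a, y) \<in> label_rel ?n w u" "(y, x) \<in> (label_rel ?n w u)\<^sup>*"
      unfolding r_def by (meson tranclD)
    have yb: "(y, b) \<in> r" using y(2) x unfolding r_def by (meson rtrancl_trancl_trancl)
    then have "y \<noteq> b" using irrefl by blast
    then show False using strict[OF y(1)] mono[OF yb] tie by simp
  qed
  have between: "(x, z) \<in> r \<and> (z, y) \<in> r \<or> (\<exists>z'. (z, z') \<in> r \<and> (z', y) \<in> r) \<or>
      (\<exists>z'. (x, z') \<in> r \<and> (z', z) \<in> r)" if "(x, y) \<in> r" "x < z" "z < y" for x y z
    using label_rel_trancl_between[OF perm below(1)] that unfolding r_def by blast
  have "(i, Suc i) \<in> (insert (b, a) (label_rel ?n w u))\<^sup>*"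
    unfolding a_def b_def by (rule label_rel_along_edge[OF w below(1) jk(1-3,5) below(2) i])
  then have "(i, b) \<in> r \<or> i = b" "(a, Suc i) \<in> r \<or> a = Suc i"
    using no unfolding rtrancl_insert r_def by (auto simp: rtrancl_eq_or_trancl)
  then consider "i = b" "(a, Suc i) \<in> r" | "a = Suc i" "(i, b) \<in> r"
    | "(i, b) \<in> r" "(a, Suc i) \<in> r" using ab by auto
  then show False
  proof cases
    case 1
    then have "(a, b) \<in> r \<and> (b, Suc i) \<in> r \<or> (\<exists>z'. (b, z') \<in> r \<and> (z', Suc i) \<in> r) \<or>
        (\<exists>z'. (a, z') \<in> r \<and> (z', b) \<in> r)"
      using between[of a "Suc i" b] ab by simp
    then show False using no cover trans 1(1) by blast
  next
    case 2
    then have "(i, a) \<in> r \<and> (a, b) \<in> r \<or> (\<exists>z'. (a, z') \<in> r \<and> (z', b) \<in> r) \<or>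
        (\<exists>z'. (i, z') \<in> r \<and> (z', a) \<in> r)"
      using between[of i b a] ab by simp
    then show False using no cover trans 2(1) by blast
  next
    case 3
    have "i \<noteq> a" "Suc i \<noteq> b" using 3 no by auto
    consider "Suc i = a" | "i = b" | "Suc i < a" | "a < i" using \<open>i \<noteq> a\<close> by linarith
    then show False
    proof cases
      case 1
      then show False using 3(2) irrefl by blast
    next
      case 2
      then show False using 3(1) irrefl by blast
    next
      case c: 3
      then have "(i, Suc i) \<in> r \<or> (Suc i, b) \<in> r"
        using between[OF 3(1), of "Suc i"] ab trans by auto
      then show False using no cover 3(2) by blast
    next
      case c: 4
      then have "(a, i) \<in> r \<or> (i, Suc i) \<in> r"
        using between[OF 3(2), of i] trans by auto
      then show False using no cover 3(1) by blast
    qed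
  qed
qed

section \<open>The join\<close>

lemma optimal_inverse:
  assumes "w permutes {1..n}" "bruhat_le n u w"
  shows "optimal n w (\<lambda>a. real (inv' u a)) u"
  unfolding optimal_iff_monotone[OF assms]
  using label_rel_increasing[OF bruhat_le_permutes[OF assms(2,1)]] by fastforce

text \<open>
  At the generator \<open>s\<^sub>i\<close> itself, the labels \<open>i\<close> and \<open>i + 1\<close> are inverted; along upward edges
  the relation between them cannot appear.
\<close>

lemma skeleton_le_above_generator:
  assumes w: "w permutes {1..CARD('n::{finite,linorder})}" and i: "1 \<le> i" "i < CARD('n)"
    and le: "(skeleton_cover TYPE('n) w)\<^sup>*\<^sup>* (adj_swap i) x"
  shows "(i, Suc i) \<notin> (label_rel CARD('n) w x)\<^sup>+"
  using le
proof (induction rule: rtranclp_induct)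
  case base
  show ?case
    using label_rel_trancl_increasing[OF adj_swap_permutes[OF i], of i "Suc i" w] by auto
next
  case (step y z)
  then show ?case using label_rel_edge_adjacent[OF w] by blast
qed

lemma label_rel_trancl_interval:
  assumes "u permutes {1..n}" "bruhat_le n u w"
    and "\<And>i. a \<le> i \<Longrightarrow> i < b \<Longrightarrow> (i, Suc i) \<notin> (label_rel n w u)\<^sup>+" and "a < b"
  shows "(a, b) \<notin> (label_rel n w u)\<^sup>+"
  using assms(3,4)
proof (induction b)
  case (Suc b)
  show ?case
  proof (cases "a = b")
    case True
    then show ?thesis using Suc.prems(1)[of b] by simp
  next
    case False
    then have "a < b" using Suc.prems(2) by simp
    then have "(a, b) \<notin> (label_rel n w u)\<^sup>+" using Suc by simp
    moreover have "(b, Suc b) \<notin> (label_rel n w u)\<^sup>+" using Suc.prems(1)[of b] \<open>a < b\<close> by simp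
    ultimately show ?thesis
      using label_rel_trancl_cotrans[OF assms(1,2), of a "Suc b" b] \<open>a < b\<close> by blast
  qed
qed simp

text \<open>
  The functional that reverses each block of \<open>I\<close> and keeps the blocks in order is maximal at
  \<open>m = max_young n w I\<close>: a neighbour of \<open>m\<close> within a block belongs to the Young subgroup, so it is
  below \<open>m\<close> by maximality. It has the only inversion of each generator.
\<close>

lemma generator_skeleton_le_max_young:
  assumes w: "w permutes {1..CARD('n::{finite,linorder})}"
    and I: "I \<subseteq> simple_generators CARD('n)" and s: "s \<in> I" "bruhat_le CARD('n) s w"
  shows "(skeleton_cover TYPE('n) w)\<^sup>*\<^sup>* s (max_young CARD('n) w I)"
proof -
  let ?n = "CARD('n)"
  define m where "m = max_young ?n w I"
  note mx = max_young_properties[OF w I, folded m_def]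
  have mI: "m \<in> young_subgroup ?n I"
    using mx(2) young_subgroup_mono[of "{s \<in> I. bruhat_le ?n s w}" I ?n] by blast
  have m: "m permutes {1..?n}" using bruhat_le_permutes[OF mx(1) w] .
  obtain i where i: "1 \<le> i" "i < ?n" "s = adj_swap i" using generatorE[OF I s(1)] .
  obtain d where d: "d permutes {1..?n}" and
    inv: "\<And>a b. a \<in> {1..?n} \<Longrightarrow> b \<in> {1..?n} \<Longrightarrow> a < b \<Longrightarrow> d b < d a \<longleftrightarrow> linked I a b"
  proof (rule exists_permutation_with_inversions[of "linked I" ?n])
    show "linked I a c" if "linked I a b" "linked I b c" for a b c
      using that unfolding linked_def by (meson not_le)
    show "linked I a b \<or> linked I b c" if "a < b" "b < c" "linked I a c" for a b c
      using that unfolding linked_def by (meson less_trans)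
  qed blast
  have "optimal ?n w (\<lambda>a. real (d a)) m"
    unfolding optimal_iff_monotone[OF w mx(1)]
  proof clarify
    fix p q assume pq: "(p, q) \<in> label_rel ?n w m"
    then obtain j k where jk: "p = m j" "q = m k" "1 \<le> j" "j < k" "k \<le> ?n"
      and le: "bruhat_le ?n (m \<circ> swap j k) w" by (rule label_relE)
    have bounds: "p \<in> {1..?n}" "q \<in> {1..?n}" using label_rel_bounds[OF m pq] .
    have "p \<noteq> q" using label_rel_increasing[OF m pq] by auto
    then consider "p < q" | "q < p" by linarith
    then show "real (d p) \<le> real (d q)"
    proof cases
      case 1
      have "\<not> linked I p q"
      proof
        assume "linked I p q"
        then have "swap p q \<circ> m \<in> young_subgroup ?n I"
          by (intro young_subgroup_mult swap_in_young_subgroup mI 1)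
        also have "swap p q \<circ> m = m \<circ> swap j k"
          using transpose_comp_eq[OF permutes_bij[OF m], of p q] jk
          by (simp add: permutes_inverses[OF m])
        finally have "bruhat_le ?n (m \<circ> swap j k) m" using mx(3) le by blast
        moreover have "refl_step ?n m (m \<circ> swap j k)"
          unfolding refl_step_def using m jk 1 by blast
        ultimately show False
          using refl_step_length bruhat_le_length by (metis less_asym less_irrefl)
      qed
      then show ?thesis using inv[OF bounds 1] by simp
    next
      case 2
      have "inv' m p < inv' m q" using label_rel_increasing[OF m pq] .
      then have "linked I q p"
        unfolding linked_def using young_subgroup_inversion[OF I mI] by blast
      then show ?thesis using inv[OF bounds(2,1) 2] by simp
    qed
  qed
  moreover have "optimal ?n w (\<lambda>a. real (s a)) s"
    using optimal_inverse[OF w s(2)] by (simp add: i(3))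
  moreover have "inversions ?n s \<subseteq> inversions ?n d"
  proof (clarify)
    fix a b assume ab: "(a, b) \<in> inversions ?n s"
    then have "a = i" "b = Suc i"
      by (auto simp: inversions_def i(3) Transposition.transpose_def split: if_splits)
    moreover have "linked I i (Suc i)"
      using s(1) i(3) by (auto simp: linked_def less_Suc_eq_le dest: antisym)
    ultimately show "(a, b) \<in> inversions ?n d"
      using ab inv[of a b] by (simp add: inversions_def)
  qed
  moreover have "s permutes {1..?n}" using bruhat_le_permutes[OF s(2) w] .
  ultimately show ?thesis
    using skeleton_le_of_inversions[OF w d] unfolding m_def by blast
qed

text \<open>
  Let \<open>d\<close> invert every pair that the order at \<open>x\<close> permits. For an upper bound \<open>x\<close> of the
  generators, these include all pairs within a block, hence all inversions of \<open>m\<close>.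
\<close>

lemma max_young_skeleton_le:
  assumes w: "w permutes {1..CARD('n::{finite,linorder})}"
    and I: "I \<subseteq> simple_generators CARD('n)" and x: "bruhat_le CARD('n) x w"
    and upper: "\<And>s. s \<in> I \<Longrightarrow> bruhat_le CARD('n) s w \<Longrightarrow> (skeleton_cover TYPE('n) w)\<^sup>*\<^sup>* s x"
  shows "(skeleton_cover TYPE('n) w)\<^sup>*\<^sup>* (max_young CARD('n) w I) x"
proof -
  let ?n = "CARD('n)" and ?J = "{s \<in> I. bruhat_le CARD('n) s w}"
  define m where "m = max_young ?n w I"
  define r where "r = (label_rel ?n w x)\<^sup>+"
  note mx = max_young_properties[OF w I, folded m_def]
  have m: "m permutes {1..?n}" using bruhat_le_permutes[OF mx(1) w] .
  have xp: "x permutes {1..?n}" using bruhat_le_permutes[OF x w] .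
  have J: "?J \<subseteq> simple_generators ?n" using I by blast
  obtain d where d: "d permutes {1..?n}" and
    inv: "\<And>a b. a \<in> {1..?n} \<Longrightarrow> b \<in> {1..?n} \<Longrightarrow> a < b \<Longrightarrow> d b < d a \<longleftrightarrow> (a, b) \<notin> r"
  proof (rule exists_permutation_with_inversions[of "\<lambda>a b. (a, b) \<notin> r" ?n])
    show "(a, c) \<notin> r" if "a < b" "b < c" "(a, b) \<notin> r" "(b, c) \<notin> r" for a b c
      using that label_rel_trancl_cotrans[OF xp x] unfolding r_def by blast
    show "(a, b) \<notin> r \<or> (b, c) \<notin> r" if "(a, c) \<notin> r" for a b c
      using that unfolding r_def by (meson trancl_trans)
  qed blast
  have "optimal ?n w (\<lambda>a. real (d a)) x"
    unfolding optimal_iff_monotone[OF w x]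
  proof clarify
    fix p q assume pq: "(p, q) \<in> label_rel ?n w x"
    have bounds: "p \<in> {1..?n}" "q \<in> {1..?n}" using label_rel_bounds[OF xp pq] .
    have less: "inv' x p < inv' x q" using label_rel_increasing[OF xp pq] .
    then have "p \<noteq> q" by auto
    then consider "p < q" | "q < p" by linarith
    then show "real (d p) \<le> real (d q)"
    proof cases
      case 1
      have "(p, q) \<in> r" using pq by (auto simp: r_def)
      then show ?thesis using inv[OF bounds 1] by simp
    next
      case 2
      have "(q, p) \<notin> r"
        using label_rel_trancl_increasing[OF xp] less unfolding r_def by (metis less_asym)
      then show ?thesis using inv[OF bounds(2,1) 2] by simp
    qed
  qed
  moreover have "inversions ?n (inv' m) \<subseteq> inversions ?n d"
  proof clarify
    fix a b assume ab: "(a, b) \<in> inversions ?n (inv' m)"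
    then have "a < b" "inv' m b < inv' m a" by (auto simp: inversions_def)
    have "(i, Suc i) \<notin> r" if "a \<le> i" "i < b" for i
    proof -
      have "adj_swap i \<in> ?J"
        by (rule young_subgroup_inversion[OF J mx(2) \<open>inv' m b < inv' m a\<close> that])
      then show ?thesis
        unfolding r_def using skeleton_le_above_generator[OF w] upper that ab
        by (simp add: inversions_def)
    qed
    then have "(a, b) \<notin> r"
      using label_rel_trancl_interval[OF xp x] \<open>a < b\<close> unfolding r_def by blast
    then show "(a, b) \<in> inversions ?n d"
      using ab inv[of a b] by (simp add: inversions_def)
  qed
  ultimately show ?thesis
    using skeleton_le_of_inversions[OF w d _ permutes_inv[OF m] optimal_inverse[OF w mx(1)]]
    unfolding m_def by blast
qed

lemma skeleton_le_antisym:
  assumes "(skeleton_cover TYPE('n::{finite,linorder}) w)\<^sup>*\<^sup>* x y"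
    and "(skeleton_cover TYPE('n) w)\<^sup>*\<^sup>* y x"
  shows "x = y"
proof -
  have "x = y \<or> coxeter_length CARD('n) x < coxeter_length CARD('n) y"
    if "(skeleton_cover TYPE('n) w)\<^sup>*\<^sup>* x y" for x y
    using that by (induction rule: rtranclp_induct) (auto simp: skeleton_cover_def)
  from this[OF assms(1)] this[OF assms(2)] show ?thesis by auto
qed

theorem theorem4p7:
  fixes w :: "nat \<Rightarrow> nat" and I :: "(nat \<Rightarrow> nat) set"
  defines "n \<equiv> CARD('n::{finite,linorder})"
    and "P \<equiv> skeleton_poset TYPE('n) w"
  assumes "w \<in> carrier (sym_group n)"
    and "I \<subseteq> simple_generators n"
  shows "is_lub P (max_young n w I) {s \<in> I. bruhat_le n s w} \<and>
    max_young n w I = \<Squnion>\<^bsub>P\<^esub> {s \<in> I. bruhat_le n s w}"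
proof -
  let ?J = "{s \<in> I. bruhat_le n s w}" and ?m = "max_young n w I"
  have w: "w permutes {1..CARD('n)}" and I: "I \<subseteq> simple_generators CARD('n)"
    using assms by (simp_all add: sym_group_carrier n_def)
  have carrier: "u \<in> carrier P \<longleftrightarrow> bruhat_le n u w" for u
    by (simp add: P_def skeleton_poset_def bruhat_ideal_iff[OF w] n_def)
  have le: "u \<sqsubseteq>\<^bsub>P\<^esub> v \<longleftrightarrow> (skeleton_cover TYPE('n) w)\<^sup>*\<^sup>* u v" for u v
    by (simp add: P_def skeleton_poset_def)
  have lub: "is_lub P ?m ?J"
    unfolding least_def
  proof (intro conjI ballI)
    show "Upper P ?J \<subseteq> carrier P" by (simp add: Upper_def)
    show "?m \<in> Upper P ?J"
      using generator_skeleton_le_max_young[OF w I] max_young_properties(1)[OF w I]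
      by (auto simp: Upper_def carrier le n_def)
    fix x assume "x \<in> Upper P ?J"
    then show "?m \<sqsubseteq>\<^bsub>P\<^esub> x"
      using max_young_skeleton_le[OF w I, of x] by (auto simp: Upper_def carrier le n_def)
  qed
  moreover have "x = ?m" if "is_lub P x ?J" for x
  proof (rule skeleton_le_antisym)
    show "(skeleton_cover TYPE('n) w)\<^sup>*\<^sup>* x ?m" "(skeleton_cover TYPE('n) w)\<^sup>*\<^sup>* ?m x"
      using that lub unfolding least_def le by auto
  qed
  with lub have "\<Squnion>\<^bsub>P\<^esub> ?J = ?m"
    unfolding sup_def by (rule some_equality)
  ultimately show ?thesis by simp
qed

end
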